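(* Let $k\ge2$ and let $f$ be a nonnegative, nondegenerate $k$-regular sequence with minimal nondegenerate linear representation $(\mathbf u,\mathcal A,\mathbf v)$. If $\rho(\widetilde{\mathbf A})$ is the unique eigenvalue of maximal modulus of $\widetilde{\mathbf A}$, then $f$ has a unique ghost measure $\mu_f$, given by the weak limit $\mu_f=\lim_{N\to\infty}\mu_N$.
   Context: Regular sequences. Fix an integer $k\ge2$. For $n\ge1$ let $(n)_k=i_s\cdots i_0$ be the base-$k$ expansion ($i_s\ne0$), and for $d\times d$ matrices $\mathbf A_0,\dots,\mathbf A_{k-1}$ put $\mathbf A_{(n)_k}=\mathbf A_{i_s}\cdots\mathbf A_{i_0}$, with $\mathbf A_{(0)_k}$ the identity. A real sequence $f=(f(n))_{n\ge0}$ is $k$-regular if its $k$-kernel $\{(f(k^\ell n+r))_{n\ge 0}:\ell\ge0,\ 0\le r<k^\ell\}$ spans a finite-dimensional real vector space $V_k(f)$; $\dim V_k(f)$ is the degree of $f$. A linear representation of $f$ of degree $d$ is a tuple $(\mathbf u,\mathcal A,\mathbf v)$ with $\mathbf u,\mathbf v\in\mathbb R^{d}$ (columns), $\mathcal A=\{\mathbf A_0,\dots,\mathbf A_{k-1}\}\subset\mathbb R^{d\times d}$ and $f(n)=\mathbf u^T\mathbf A_{(n)_k}\mathbf v$ for all $n\ge 0$; it is minimal if $d=\dim V_k(f)$. Put $\mathbf A=\sum_{j=0}^{k-1}\mathbf A_j$. Ghost measures. For nonnegative $f$ put $\Sigma_f(N)=\sum_{m=k^N}^{k^{N+1}-1}f(m)$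 and, when $\Sigma_f(N)\neq0$, $\mu_N=\frac1{\Sigma_f(N)}\sum_{m=0}^{k^{N+1}-k^N-1}f(k^N+m)\,\delta_{m/(k^N(k-1))}$, a probability measure on $\mathbb T=[0,1)$ with addition mod $1$. Ghost measures of $f$ are the weak accumulation points of $(\mu_N)_N$. Nondegeneracy. Let $V\subset\mathbb R^d$ be the subspace with $V^T=\mathrm{span}\{\mathbf u^T\mathbf A_{(n)_k}:n\ge1\}$, $\mathbf P_V$ the orthogonal projection onto $V$, $\widetilde{\mathbf A}=\mathbf P_V\mathbf A\mathbf P_V$, $\rho=\rho(\widetilde{\mathbf A})$ the spectral radius, $\{g_1\rho,\dots,g_s\rho\}$ ($|g_i|=1$) the set of eigenvalues of $\widetilde{\mathbf A}$ of modulus $\rho$, $g=(g_1,\dots,g_s)$ and $G=\overline{\{g^n:n\in\mathbb N\}}$ (closure in the $s$-fold product of the complex unit circle, componentwise multiplication). For $h\in G$ let $\mathbf R_h$ be multiplication by $h_m$ on the generalised eigenspace in $V$ (complexified) of $\widetilde{\mathbf A}$ for $g_m\rho$, and the identity on the other generalised eigenspaces in $V$ and on $V^\perp$; $\mathbf R=\mathbf R_{g^{-1}}$. Let $r$ be the maximal size of a Jordan block of $\widetilde{\mathbf A}$ for an eigenvalue of modulus $\rho$, $c_n=\frac{(r-1)!}{n^{r-1}\rho^{n-r+1}}$, and $\mathbf P=\lim_{n\to\infty}c_n\mathbf R^n\widetilde{\mathbf A}^n$ (the limit exists). The representation is nondegenerate if $\rho>0$ and $\mathbf u^T(\mathbf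 A-\mathbf A_0)\mathbf R_h\mathbf P\mathbf v>0$ for all $h\in G$. The sequence $f$ is nondegenerate if it has a minimal nondegenerate linear representation. (When $\rho$ is the unique eigenvalue of maximal modulus, $G$ is trivial and $\mathbf R$ is the identity.) *)

theory Defs
  imports
    "HOL-Probability.Probability"
    "HOL-Library.Function_Algebras"
    "Jordan_Normal_Form.Spectral_Radius"
    "Jordan_Normal_Form.Jordan_Normal_Form_Uniqueness"
begin

section \<open>Regular sequences\<close>

text \<open>Addition and zero of sequences are the pointwise ones of \<^theory>\<open>HOL-Library.Function_Algebras\<close>.\<close>

definition seq_scale :: "real \<Rightarrow> (nat \<Rightarrow> real) \<Rightarrow> nat \<Rightarrow> real" where
  "seq_scale c f = (\<lambda>n. c * f n)"

lemma vector_space_seq: "vector_space seq_scale"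
  by unfold_locales (auto simp: seq_scale_def fun_eq_iff algebra_simps)

definition k_kernel :: "nat \<Rightarrow> (nat \<Rightarrow> real) \<Rightarrow> (nat \<Rightarrow> real) set" where
  "k_kernel k f = {(\<lambda>n. f (k ^ l * n + r)) | l r. r < k ^ l}"

definition kernel_space :: "nat \<Rightarrow> (nat \<Rightarrow> real) \<Rightarrow> (nat \<Rightarrow> real) set" where
  "kernel_space k f = Modules.module.span seq_scale (k_kernel k f)"

definition k_regular :: "nat \<Rightarrow> (nat \<Rightarrow> real) \<Rightarrow> bool" where
  "k_regular k f \<longleftrightarrow> (\<exists>B. finite B \<and> kernel_space k f = Modules.module.span seq_scale B)"

definition regular_degree :: "nat \<Rightarrow> (nat \<Rightarrow> real) \<Rightarrow> nat" where
  "regular_degree k f = Vector_Spaces.vector_space.dim seq_scale (kernel_space k f)"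

text \<open>
  The product \<open>A i\<^sub>s * \<dots> * A i\<^sub>0\<close> over the base-\<open>k\<close> digits of \<open>n\<close>, most significant
  digit first. The guard \<open>k < 2\<close> only serves termination. A tuple of \<open>k\<close> matrices is
  a function \<open>nat \<Rightarrow> real mat\<close> of which only the values below \<open>k\<close> matter.
\<close>

function digit_mat :: "nat \<Rightarrow> nat \<Rightarrow> (nat \<Rightarrow> real mat) \<Rightarrow> nat \<Rightarrow> real mat" where
  "digit_mat d k A n =
     (if k < 2 \<or> n = 0 then 1\<^sub>m d else digit_mat d k A (n div k) * A (n mod k))"
  by pat_completeness auto
termination by (relation "Wellfounded.measure (\<lambda>(d, k, A, n). n)") auto

declare digit_mat.simps [simp del]

definition linear_rep ::
  "nat \<Rightarrow> (nat \<Rightarrow> real) \<Rightarrow> nat \<Rightarrow> real Matrix.vec \<Rightarrow> (nat \<Rightarrow> real mat) \<Rightarrow> real Matrix.vec \<Rightarrow> bool" where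
  "linear_rep k f d u A v \<longleftrightarrow>
     u \<in> carrier_vec d \<and> v \<in> carrier_vec d \<and> (\<forall>j<k. A j \<in> carrier_mat d d) \<and>
     (\<forall>n. f n = scalar_prod u (digit_mat d k A n *\<^sub>v v))"

definition minimal_rep ::
  "nat \<Rightarrow> (nat \<Rightarrow> real) \<Rightarrow> nat \<Rightarrow> real Matrix.vec \<Rightarrow> (nat \<Rightarrow> real mat) \<Rightarrow> real Matrix.vec \<Rightarrow> bool" where
  "minimal_rep k f d u A v \<longleftrightarrow> linear_rep k f d u A v \<and> d = regular_degree k f"


section \<open>Ghost measures\<close>

definition block_sum :: "nat \<Rightarrow> (nat \<Rightarrow> real) \<Rightarrow> nat \<Rightarrow> real" where
  "block_sum k f N = (\<Sum>m\<in>{k ^ N..<k ^ (N + 1)}. f m)"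

text \<open>
  The torus is \<open>[0,1)\<close>. Its topology (that of \<open>\<real>/\<int>\<close>) differs from that of the half-open
  interval, but the Borel sigma-algebras agree. A function on the torus is continuous iff its
  1-periodic extension to the real line is.
\<close>

definition torus :: "real measure" where
  "torus = restrict_space borel {0..<1}"

definition torus_continuous :: "(real \<Rightarrow> real) \<Rightarrow> bool" where
  "torus_continuous \<phi> \<longleftrightarrow> continuous_on UNIV (\<lambda>x. \<phi> (frac x))"

text \<open>A sum of weighted point masses, as the image of a weighted counting measure.
  If \<open>block_sum k f N = 0\<close> this is the null measure, which is not a probability measure.\<close>

definition block_measure :: "nat \<Rightarrow> (nat \<Rightarrow> real) \<Rightarrow> nat \<Rightarrow> real measure" where
  "block_measure k f N =
     distr (point_measure {0..<k ^ (N + 1) - k ^ N} (\<lambda>m. ennreal (f (k ^ N + m) / block_sum k f N)))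
       torus (\<lambda>m. real m / real (k ^ N * (k - 1)))"

definition torus_probs :: "real measure set" where
  "torus_probs = {\<nu>. prob_space \<nu> \<and> sets \<nu> = sets torus}"

definition weak_topology :: "real measure topology" where
  "weak_topology = topology_generated_by
     {{\<nu> \<in> torus_probs. integral\<^sup>L \<nu> \<phi> \<in> U} | \<phi> U. torus_continuous \<phi> \<and> open U}"

definition ghost_measure :: "nat \<Rightarrow> (nat \<Rightarrow> real) \<Rightarrow> real measure \<Rightarrow> bool" where
  "ghost_measure k f \<nu> \<longleftrightarrow>
     \<nu> \<in> torus_probs \<and>
     (\<forall>W. openin weak_topology W \<and> \<nu> \<in> W \<longrightarrow>
        (\<exists>\<^sub>F N in sequentially. block_sum k f N \<noteq> 0 \<and> block_measure k f N \<in> W))"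


section \<open>Nondegeneracy\<close>

definition rep_space ::
  "nat \<Rightarrow> nat \<Rightarrow> real Matrix.vec \<Rightarrow> (nat \<Rightarrow> real mat) \<Rightarrow> real Matrix.vec set" where
  "rep_space d k u A = LinearCombinations.module.span class_ring (module_vec TYPE(real) d)
     {transpose_mat (digit_mat d k A n) *\<^sub>v u | n. n \<ge> 1}"

definition orth_compl :: "nat \<Rightarrow> real Matrix.vec set \<Rightarrow> real Matrix.vec set" where
  "orth_compl d V = {x \<in> carrier_vec d. \<forall>w\<in>V. scalar_prod x w = 0}"

definition orth_proj :: "nat \<Rightarrow> real Matrix.vec set \<Rightarrow> real mat" where
  "orth_proj d V = (THE P. P \<in> carrier_mat d d \<and>
     (\<forall>x\<in>carrier_vec d. P *\<^sub>v x \<in> V \<and> x - P *\<^sub>v x \<in> orth_compl d V))"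

definition total_mat :: "nat \<Rightarrow> nat \<Rightarrow> (nat \<Rightarrow> real mat) \<Rightarrow> real mat" where
  "total_mat d k A = Matrix.mat d d (\<lambda>ij. \<Sum>j<k. A j $$ ij)"

definition tilde_mat :: "nat \<Rightarrow> nat \<Rightarrow> real Matrix.vec \<Rightarrow> (nat \<Rightarrow> real mat) \<Rightarrow> complex mat" where
  "tilde_mat d k u A = (let P = orth_proj d (rep_space d k u A) in
     map_mat complex_of_real (P * total_mat d k A * P))"

definition complexification :: "nat \<Rightarrow> real Matrix.vec set \<Rightarrow> complex Matrix.vec set" where
  "complexification d W = {x \<in> carrier_vec d. map_vec Re x \<in> W \<and> map_vec Im x \<in> W}"

definition gen_eigenspace :: "complex mat \<Rightarrow> complex \<Rightarrow> complex Matrix.vec set" where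
  "gen_eigenspace M z = (\<Union>m. mat_kernel (char_matrix M z ^\<^sub>m m))"

definition peripheral :: "complex mat \<Rightarrow> complex set" where
  "peripheral M = {z. eigenvalue M z \<and> cmod z = spectral_radius M}"

text \<open>
  Tuples indexed by the peripheral eigenvalues \<open>g\<^sub>m \<rho>\<close> are represented as functions on
  the complex numbers with the value 1 off the peripheral eigenvalues. The closure
  below is taken in the product topology on functions; the constant coordinates
  do not affect it.
\<close>

definition phases :: "complex mat \<Rightarrow> complex \<Rightarrow> complex" where
  "phases M = (\<lambda>z. if z \<in> peripheral M then z / complex_of_real (spectral_radius M) else 1)"

definition phase_group :: "complex mat \<Rightarrow> (complex \<Rightarrow> complex) set" where
  "phase_group M = closure {(\<lambda>z. phases M z ^ n) | n. True}"

definition rotation_mat ::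
  "nat \<Rightarrow> real Matrix.vec set \<Rightarrow> complex mat \<Rightarrow> (complex \<Rightarrow> complex) \<Rightarrow> complex mat" where
  "rotation_mat d V M h = (THE R. R \<in> carrier_mat d d \<and>
     (\<forall>z\<in>peripheral M. \<forall>x\<in>gen_eigenspace M z \<inter> complexification d V. R *\<^sub>v x = h z \<cdot>\<^sub>v x) \<and>
     (\<forall>z. z \<notin> peripheral M \<longrightarrow>
        (\<forall>x\<in>gen_eigenspace M z \<inter> complexification d V. R *\<^sub>v x = x)) \<and>
     (\<forall>x\<in>complexification d (orth_compl d V). R *\<^sub>v x = x))"

definition max_jordan_size :: "complex mat \<Rightarrow> nat" where
  "max_jordan_size M = Max {m. \<exists>n_as z. jordan_nf M n_as \<and> (m, z) \<in> set n_as \<and>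
     cmod z = spectral_radius M}"

definition growth_coeff :: "complex mat \<Rightarrow> nat \<Rightarrow> real" where
  "growth_coeff M n = (let r = max_jordan_size M in
     fact (r - 1) / (real n ^ (r - 1) * spectral_radius M powi (int n - int r + 1)))"

text \<open>Matrix limits are taken entrywise.\<close>

definition limit_mat :: "nat \<Rightarrow> real Matrix.vec set \<Rightarrow> complex mat \<Rightarrow> complex mat" where
  "limit_mat d V M = (let R = rotation_mat d V M (\<lambda>z. inverse (phases M z)) in
     Matrix.mat d d (\<lambda>ij. lim (\<lambda>n. complex_of_real (growth_coeff M n) * (R ^\<^sub>m n * M ^\<^sub>m n) $$ ij)))"

text \<open>The order on the complex numbers is that of \<^theory>\<open>HOL-Library.Complex_Order\<close>: \<open>0 < z\<close> means that
  \<open>z\<close> is real and positive.\<close>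

definition nondegenerate_rep ::
  "nat \<Rightarrow> nat \<Rightarrow> real Matrix.vec \<Rightarrow> (nat \<Rightarrow> real mat) \<Rightarrow> real Matrix.vec \<Rightarrow> bool" where
  "nondegenerate_rep k d u A v \<longleftrightarrow>
     (let V = rep_space d k u A; M = tilde_mat d k u A in
        spectral_radius M > 0 \<and>
        (\<forall>h\<in>phase_group M.
           0 < scalar_prod (map_vec complex_of_real u)
                 (map_mat complex_of_real (total_mat d k A - A 0) *\<^sub>v
                   (rotation_mat d V M h *\<^sub>v
                     (limit_mat d V M *\<^sub>v map_vec complex_of_real v)))))"

definition nondegenerate :: "nat \<Rightarrow> (nat \<Rightarrow> real) \<Rightarrow> bool" where
  "nondegenerate k f \<longleftrightarrow>
     (\<exists>d u A v. minimal_rep k f d u A v \<and> nondegenerate_rep k d u A v)"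

end

theory Submission
  imports Defs
begin

text \<open>
  Write \<open>M = P\<^sub>V A P\<^sub>V\<close>. Every vector \<open>w\<close> in \<open>V\<close> satisfies \<open>w \<cdot> A\<^sup>n v = w \<cdot> M\<^sup>n v\<close>, because \<open>V\<close> is
  invariant under the transposed digit matrices. Hence the mass that \<open>f\<close> puts on the numbers
  with a digit prefix \<open>q\<close> and \<open>n\<close> further digits is \<open>w \<cdot> M\<^sup>n v\<close> for a vector \<open>w\<close> in \<open>V\<close> depending only on
  \<open>q\<close>. If the spectral radius is the only peripheral eigenvalue, all rotations are trivial, and the
  Jordan form shows that these masses converge after multiplication with the growth coefficient;
  nondegeneracy says that the limit of the total mass is positive. So the relative masses of all
  cells of the \<open>k\<close>-adic partition converge, which makes the integrals of every continuous function on
  the circle a Cauchy sequence, and Helly selection provides a measure representing the limits.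
\<close>

text \<open>The definitions of \<open>orth_proj\<close>, \<open>rotation_mat\<close> and
  \<open>limit_mat\<close> rest on \<open>THE\<close> and \<open>lim\<close>, so nondegeneracy
  carries no information until these are shown to denote the intended objects. For the projection,
  existence comes from enlarging partial projections until the trace is maximal. For the rotation
  with all factors 1, the identity is the evident candidate and the work lies in uniqueness: the
  generalised eigenvectors of \<open>M\<close>, projected into the complexified \<open>V\<close>,
  must determine a matrix there. The Jordan form alone gives only convergence after normalisation;
  the limit could be 0. Nondegeneracy, read at the trivial phase, excludes this for the whole block,
  and only then may cell masses be divided by block masses. Both are normalised by the same
  \<open>growth_coeff M N\<close>, which cancels. A prefix \<open>q\<close> with
  \<open>k ^ l \<le> q < k ^ (l + 1)\<close> leaves only \<open>N - l\<close> free digits, so its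
  mass is governed by an earlier power of \<open>M\<close>; the mismatch is the factor
  \<open>1 / \<rho> ^ l\<close> of \<open>growth_coeff_shift\<close>, where \<open>\<rho>\<close> is
  the spectral radius.\<close>

no_notation Finite_Cartesian_Product.vec_nth (infixl "$" 90)

section \<open>Weak convergence on the torus\<close>

lemma space_torus [simp]: "space torus = {0..<1}"
  by (simp add: torus_def space_restrict_space)

lemma sets_torus_borel: "B \<in> sets torus \<Longrightarrow> B \<in> sets borel"
  by (auto simp: torus_def sets_restrict_space)

lemma frac_measurable_torus: "frac \<in> measurable borel torus"
proof -
  have "(frac :: real \<Rightarrow> real) \<in> borel_measurable borel"
    unfolding frac_def by (intro borel_measurable_diff borel_measurable_real_floor) auto
  then show ?thesis
    unfolding torus_def by (intro measurable_restrict_space2) (auto simp: frac_lt_1)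
qed

lemma torus_continuous_bounded:
  assumes "torus_continuous \<phi>"
  obtains B where "\<And>x. \<bar>\<phi> (frac x)\<bar> \<le> B"
proof -
  have "compact ((\<lambda>x. \<phi> (frac x)) ` {0..1})"
    using assms unfolding torus_continuous_def
    by (intro compact_continuous_image) (auto intro: continuous_on_subset)
  then obtain B where B: "\<forall>x\<in>{0..1}. \<bar>\<phi> (frac x)\<bar> \<le> B"
    by (auto dest!: compact_imp_bounded simp: bounded_iff)
  have "\<bar>\<phi> (frac x)\<bar> \<le> B" for x
    using bspec[OF B, of "frac x"] by (simp add: less_imp_le[OF frac_lt_1])
  then show ?thesis by (rule that)
qed

lemma torus_continuous_borel_measurable:
  assumes "torus_continuous \<phi>"
  shows "(\<lambda>x. \<phi> (frac x)) \<in> borel_measurable borel" "\<phi> \<in> borel_measurable torus"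
proof -
  show *: "(\<lambda>x. \<phi> (frac x)) \<in> borel_measurable borel"
    using assms unfolding torus_continuous_def by (rule borel_measurable_continuous_onI)
  have "\<phi> \<in> borel_measurable torus \<longleftrightarrow> (\<lambda>x. \<phi> (frac x)) \<in> borel_measurable torus"
    by (rule measurable_cong) (simp add: frac_eq)
  also have "\<dots>"
    unfolding torus_def by (rule measurable_restrict_space1[OF *])
  finally show "\<phi> \<in> borel_measurable torus" .
qed

lemma space_torus_probs: "\<nu> \<in> torus_probs \<Longrightarrow> space \<nu> = {0..<1}"
  using sets_eq_imp_space_eq[of \<nu> torus] by (simp add: torus_probs_def)

text \<open>The cosine of \<open>2 * pi * x\<close> has period 1, so \<open>frac\<close> drops out
  and only continuity on the line is left.\<close>

lemma torus_continuous_trig: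
  "torus_continuous (\<lambda>x. min 1 (real n * max 0 (cos (2 * pi * (x - c)) - w)))"
proof -
  have "cos (2 * pi * (frac x - c)) = cos (2 * pi * (x - c))" for x
  proof -
    have "2 * pi * (frac x - c) = 2 * pi * (x - c) - 2 * pi * of_int \<lfloor>x\<rfloor>"
      by (simp add: frac_def algebra_simps)
    then show ?thesis
      by (simp add: cos_diff)
  qed
  then show ?thesis
    unfolding torus_continuous_def by (simp) (intro continuous_intros)
qed

text \<open>The point \<open>(1 + t) / 2\<close> is the midpoint of the arc from \<open>t\<close> to
  1 and \<open>(1 - t) / 2\<close> is half its length. On the circle the cosine decreases with the
  distance from the midpoint, so it exceeds its value at the endpoints exactly inside the
  arc.\<close>

lemma cos_arc_iff:
  assumes "0 \<le> t" "t < 1" "x \<in> {0..<1}"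
  shows "cos (2 * pi * (x - (1 + t) / 2)) > cos (2 * pi * ((1 - t) / 2)) \<longleftrightarrow> t < x"
proof -
  define w where "w = (1 - t) / 2"
  define y where "y = x - (1 + t) / 2"
  have w: "0 < w" "w \<le> 1/2" using assms by (auto simp: w_def)
  have c: "cos (2 * pi * a) > cos (2 * pi * w) \<longleftrightarrow> a < w" if "0 \<le> a" "a \<le> 1/2" for a
    using that w by (subst cos_mono_less_eq) (auto simp: field_simps)
  show ?thesis unfolding y_def[symmetric] w_def[symmetric]
  proof (cases "y \<ge> 0")
    case True
    then have "y < w" "t < x" using assms by (auto simp: y_def w_def field_simps)
    then show "cos (2 * pi * w) < cos (2 * pi * y) \<longleftrightarrow> t < x" using c[of y] True w by auto
  next
    case False
    show "cos (2 * pi * w) < cos (2 * pi * y) \<longleftrightarrow> t < x"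
    proof (cases "y \<ge> -1/2")
      case True
      have "cos (2 * pi * y) = cos (2 * pi * (-y))" by simp
      then show ?thesis using c[of "-y"] True False by (auto simp: y_def w_def field_simps)
    next
      case F2: False
      \<comment> \<open>Here the shorter way from \<open>x\<close> to the midpoint passes through 0,
        so a full turn is added. The distance is then \<open>y + 1 = x + w\<close>, at least
        \<open>w\<close> because \<open>x\<close> is nonnegative.\<close>
      have "cos (2 * pi * y) = cos (2 * pi * y + 2 * pi)" by simp
      then have "cos (2 * pi * y) = cos (2 * pi * (y + 1))" by (simp only: ring_distribs mult_1_right)
      moreover have "0 \<le> y + 1" "y + 1 \<le> 1/2" "y + 1 \<ge> w" "x \<le> t"
        using F2 assms by (auto simp: y_def w_def field_simps)
      ultimately show ?thesis using c[of "y + 1"] by auto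
    qed
  qed
qed

text \<open>Trigonometric test functions are automatically continuous on the circle; truncated, they
  increase to the indicator of an arc.\<close>

lemma torus_measure_arc:
  assumes \<nu>: "\<nu> \<in> torus_probs" and t: "0 \<le> t" "t < 1"
  shows "(\<lambda>n. \<integral>x. min 1 (real n * max 0 (cos (2 * pi * (x - (1 + t) / 2)) - cos (2 * pi * ((1 - t) / 2)))) \<partial>\<nu>)
    \<longlonglongrightarrow> measure \<nu> {t<..<1}"
proof -
  interpret prob_space \<nu> using \<nu> by (simp add: torus_probs_def)
  have sets: "sets \<nu> = sets torus" using \<nu> by (simp add: torus_probs_def)
  note sp = space_torus_probs[OF \<nu>]
  have "{0..<1} \<inter> {t<..<1} \<in> sets torus"
    unfolding torus_def sets_restrict_space by (rule imageI) simp
  also have "{0..<1} \<inter> {t<..<1} = {t<..<1}" using t by auto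
  finally have m: "{t<..<1} \<in> sets \<nu>" by (simp add: sets)
  let ?\<phi> = "\<lambda>n x. min 1 (real n * max 0 (cos (2 * pi * (x - (1 + t) / 2)) - cos (2 * pi * ((1 - t) / 2))))"
  have "(\<lambda>n. \<integral>x. ?\<phi> n x \<partial>\<nu>) \<longlonglongrightarrow> (\<integral>x. indicat_real {t<..<1} x \<partial>\<nu>)"
  proof (rule integral_dominated_convergence[where w="\<lambda>_. 1"])
    show "?\<phi> n \<in> borel_measurable \<nu>" for n
      using torus_continuous_borel_measurable(2)[OF torus_continuous_trig]
      by (simp cong: measurable_cong_sets add: sets)
    show "indicat_real {t<..<1} \<in> borel_measurable \<nu>" using m by simp
    show "AE x in \<nu>. norm (?\<phi> n x) \<le> 1" for n
      by (rule AE_I2) auto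
    show "AE x in \<nu>. (\<lambda>n. ?\<phi> n x) \<longlonglongrightarrow> indicat_real {t<..<1} x"
    proof (rule AE_I2)
      fix x assume "x \<in> space \<nu>"
      then have x: "x \<in> {0..<1}" by (simp add: sp)
      define D where "D = cos (2 * pi * (x - (1 + t) / 2)) - cos (2 * pi * ((1 - t) / 2))"
      have D: "D > 0 \<longleftrightarrow> t < x" using cos_arc_iff[OF t x] by (auto simp: D_def)
      show "(\<lambda>n. ?\<phi> n x) \<longlonglongrightarrow> indicat_real {t<..<1} x"
        unfolding D_def[symmetric]
      proof (cases "t < x")
        case True
        then have "D > 0" using D by simp
        then obtain n0 where n0: "1 \<le> real n0 * D"
          using reals_Archimedean3 by (metis less_imp_le)
        have "eventually (\<lambda>n. min 1 (real n * max 0 D) = 1) sequentially"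
          using eventually_ge_at_top[of n0]
        proof eventually_elim
          case (elim n)
          then have "real n0 * D \<le> real n * D" using \<open>D > 0\<close> by (intro mult_right_mono) auto
          then have "1 \<le> real n * D" using n0 by linarith
          then have "1 \<le> real n * max 0 D" using \<open>D > 0\<close> by simp
          then show ?case by simp
        qed
        then show "(\<lambda>n. min 1 (real n * max 0 D)) \<longlonglongrightarrow> indicat_real {t<..<1} x"
          using True x by (simp add: tendsto_eventually)
      qed (use D in auto)
    qed
  qed simp
  then show ?thesis by (simp add: m)
qed

text \<open>Continuous integrals determine the masses of the arcs \<open>{t<..<1}\<close> by
  \<open>torus_measure_arc\<close>. Transported to the real line, these are the masses of the
  half-lines \<open>{t<..}\<close>, which determine a finite Borel measure.\<close>

lemma torus_probs_eqI:
  assumes \<nu>: "\<nu> \<in> torus_probs" and \<mu>: "\<mu> \<in> torus_probs"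
    and eq: "\<And>\<phi>. torus_continuous \<phi> \<Longrightarrow> integral\<^sup>L \<nu> \<phi> = integral\<^sup>L \<mu> \<phi>"
  shows "\<nu> = \<mu>"
proof -
  let ?E = "\<lambda>\<nu>. distr \<nu> borel (\<lambda>x. x :: real)"
  have id: "(\<lambda>x. x) \<in> borel_measurable \<nu>" if "\<nu> \<in> torus_probs" for \<nu>
    using that unfolding torus_probs_def torus_def by (auto cong: measurable_cong_sets intro: measurable_restrict_space1)
  have E: "emeasure (?E \<nu>) B = emeasure \<nu> (B \<inter> {0..<1})" if "\<nu> \<in> torus_probs" "B \<in> sets borel" for \<nu> B
    using that by (subst emeasure_distr[OF id]) (auto simp: space_torus_probs)
  have "?E \<nu> = ?E \<mu>"
  proof (rule measure_eqI_lessThan)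
    fix t :: real
    interpret N: prob_space \<nu> using \<nu> by (simp add: torus_probs_def)
    interpret M: prob_space \<mu> using \<mu> by (simp add: torus_probs_def)
    show "emeasure (?E \<nu>) {t<..} < \<infinity>" by (simp add: E[OF \<nu>] N.emeasure_eq_measure)
    show "emeasure (?E \<nu>) {t<..} = emeasure (?E \<mu>) {t<..}"
    proof -
      consider "t < 0" | "0 \<le> t" "t < 1" | "t \<ge> 1" by linarith
      then show ?thesis
      proof cases
        case 1
        then have "{t<..} \<inter> {0..<1} = {0..<1}" by auto
        then show ?thesis
          using N.emeasure_space_1 M.emeasure_space_1
          by (simp add: E[OF \<nu>] E[OF \<mu>] space_torus_probs[OF \<nu>] space_torus_probs[OF \<mu>])
      next
        case 2
        have "measure \<nu> {t<..<1} = measure \<mu> {t<..<1}"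
          using torus_measure_arc[OF \<nu> 2] torus_measure_arc[OF \<mu> 2] eq[OF torus_continuous_trig]
          by (auto intro: LIMSEQ_unique)
        moreover have "{t<..} \<inter> {0..<1} = {t<..<1}" using 2 by auto
        ultimately show ?thesis
          by (simp add: E[OF \<nu>] E[OF \<mu>] N.emeasure_eq_measure M.emeasure_eq_measure)
      next
        case 3
        then have "{t<..} \<inter> {0..<1} = {}" by auto
        then show ?thesis by (simp add: E[OF \<nu>] E[OF \<mu>])
      qed
    qed
  qed auto
  show ?thesis
  proof (rule measure_eqI)
    show "sets \<nu> = sets \<mu>" using \<nu> \<mu> by (simp add: torus_probs_def)
    fix B assume "B \<in> sets \<nu>"
    then have "B \<in> sets torus" using \<nu> by (simp add: torus_probs_def)
    then have "B \<in> sets borel" "B \<inter> {0..<1} = B"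
      using sets.sets_into_space[of B torus] by (auto intro: sets_torus_borel)
    then show "emeasure \<nu> B = emeasure \<mu> B"
      using E[OF \<nu>, of B] E[OF \<mu>, of B] \<open>?E \<nu> = ?E \<mu>\<close> by simp
  qed
qed

section \<open>The weak topology, its limits and accumulation points\<close>

lemma topspace_weak_topology: "topspace weak_topology = torus_probs"
proof -
  have "torus_continuous (\<lambda>_. 0)" by (simp add: torus_continuous_def)
  moreover have "{\<nu> \<in> torus_probs. integral\<^sup>L \<nu> (\<lambda>_. 0) \<in> UNIV} = torus_probs" by simp
  ultimately show ?thesis
    unfolding weak_topology_def topology_generated_by_topspace
    by (intro equalityI Union_least subsetI UnionI[of torus_probs]) (auto intro!: exI[of _ "\<lambda>_. 0"] exI[of _ UNIV])
qed

text \<open>Convergence of integrals handles the generating sets; being eventually entered passes to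
  finite intersections and to unions, hence, by induction, to all open sets.\<close>

lemma limitin_weak_topologyI:
  assumes \<mu>: "\<mu> \<in> torus_probs" and M: "\<forall>\<^sub>F n in F. M n \<in> torus_probs"
    and lim: "\<And>\<phi>. torus_continuous \<phi> \<Longrightarrow> ((\<lambda>n. integral\<^sup>L (M n) \<phi>) \<longlongrightarrow> integral\<^sup>L \<mu> \<phi>) F"
  shows "limitin weak_topology M \<mu> F"
  unfolding limitin_def topspace_weak_topology
proof (intro conjI allI impI)
  fix W assume W: "openin weak_topology W \<and> \<mu> \<in> W"
  then have "generate_topology_on {{\<nu> \<in> torus_probs. integral\<^sup>L \<nu> \<phi> \<in> U} | \<phi> U. torus_continuous \<phi> \<and> open U} W"
    unfolding weak_topology_def by (simp add: openin_topology_generated_by_iff)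
  then have "\<mu> \<in> W \<longrightarrow> (\<forall>\<^sub>F n in F. M n \<in> W)"
  proof induction
    case (Int a b)
    then show ?case by (auto intro: eventually_conj)
  next
    case (UN K)
    show ?case
    proof
      assume "\<mu> \<in> \<Union>K"
      then obtain a where a: "a \<in> K" "\<mu> \<in> a" by blast
      then have "\<forall>\<^sub>F n in F. M n \<in> a" using UN by blast
      then show "\<forall>\<^sub>F n in F. M n \<in> \<Union>K" by (rule eventually_mono) (use a in blast)
    qed
  next
    case (Basis s)
    then obtain \<phi> U where s: "s = {\<nu> \<in> torus_probs. integral\<^sup>L \<nu> \<phi> \<in> U}" "torus_continuous \<phi>" "open U"
      by auto
    show ?case
    proof
      assume "\<mu> \<in> s"
      then have "\<forall>\<^sub>F n in F. integral\<^sup>L (M n) \<phi> \<in> U"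
        using s by (intro topological_tendstoD[OF lim]) auto
      with M show "\<forall>\<^sub>F n in F. M n \<in> s"
        unfolding s(1) by eventually_elim auto
    qed
  qed auto
  then show "\<forall>\<^sub>F n in F. M n \<in> W" using W by simp
qed (use \<mu> in simp)

text \<open>A limit is an accumulation point, and the only one: if a test function separates
  \<open>\<nu>\<close> from \<open>\<mu>\<close>, disjoint open sets of reals pull back to disjoint
  weak neighbourhoods, and the sequence cannot be frequently in one while eventually in the
  other.\<close>

lemma ghost_measure_iff_limit:
  assumes lim: "limitin weak_topology (block_measure k f) \<mu> sequentially"
    and nz: "\<forall>\<^sub>F N in sequentially. block_sum k f N \<noteq> 0"
  shows "ghost_measure k f \<nu> \<longleftrightarrow> \<nu> = \<mu>"
proof
  have \<mu>: "\<mu> \<in> torus_probs"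
    using lim unfolding limitin_def topspace_weak_topology by simp
  show "ghost_measure k f \<nu>" if "\<nu> = \<mu>"
    unfolding ghost_measure_def
  proof (intro conjI allI impI)
    show "\<nu> \<in> torus_probs" using \<mu> that by simp
    fix W assume "openin weak_topology W \<and> \<nu> \<in> W"
    then have "\<forall>\<^sub>F N in sequentially. block_measure k f N \<in> W"
      using lim that unfolding limitin_def by blast
    with nz have "\<forall>\<^sub>F N in sequentially. block_sum k f N \<noteq> 0 \<and> block_measure k f N \<in> W"
      by (rule eventually_conj)
    then show "\<exists>\<^sub>F N in sequentially. block_sum k f N \<noteq> 0 \<and> block_measure k f N \<in> W"
      by (rule eventually_frequently[OF sequentially_bot])
  qed
  assume g: "ghost_measure k f \<nu>"
  then have \<nu>: "\<nu> \<in> torus_probs" by (simp add: ghost_measure_def)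
  show "\<nu> = \<mu>"
  proof (rule torus_probs_eqI[OF \<nu> \<mu>], rule ccontr)
    fix \<phi> assume \<phi>: "torus_continuous \<phi>" and "integral\<^sup>L \<nu> \<phi> \<noteq> integral\<^sup>L \<mu> \<phi>"
    then obtain U U' where U: "open U" "open U'" "integral\<^sup>L \<nu> \<phi> \<in> U" "integral\<^sup>L \<mu> \<phi> \<in> U'" "U \<inter> U' = {}"
      using hausdorff[of "integral\<^sup>L \<nu> \<phi>" "integral\<^sup>L \<mu> \<phi>"] by blast
    let ?W = "\<lambda>U. {\<nu> \<in> torus_probs. integral\<^sup>L \<nu> \<phi> \<in> U}"
    have op: "openin weak_topology (?W U)" if "open U" for U
      unfolding weak_topology_def using that \<phi> by (intro topology_generated_by_Basis) auto
    have "\<forall>\<^sub>F N in sequentially. block_measure k f N \<in> ?W U'"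
      using lim op[OF U(2)] U(4) \<mu> unfolding limitin_def by blast
    moreover have "\<exists>\<^sub>F N in sequentially. block_sum k f N \<noteq> 0 \<and> block_measure k f N \<in> ?W U"
      using g op[OF U(1)] U(3) \<nu> unfolding ghost_measure_def by blast
    ultimately have "\<exists>\<^sub>F N in sequentially. block_measure k f N \<in> ?W U' \<and>
        block_sum k f N \<noteq> 0 \<and> block_measure k f N \<in> ?W U"
      by (rule frequently_eventually_conj[rotated])
    then show False using U(5) by (auto dest: frequently_ex)
  qed
qed

text \<open>Helly selection on the real line may leave mass at the point 1; the image under
  \<^const>\<open>frac\<close> moves it to 0, where it belongs on the circle.\<close>

lemma torus_probs_limit_exists:
  assumes M: "\<And>n. M n \<in> torus_probs"
    and conv: "\<And>\<phi>. torus_continuous \<phi> \<Longrightarrow> convergent (\<lambda>n. integral\<^sup>L (M n) \<phi>)"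
  obtains \<mu> where "\<mu> \<in> torus_probs"
    "\<And>\<phi>. torus_continuous \<phi> \<Longrightarrow> (\<lambda>n. integral\<^sup>L (M n) \<phi>) \<longlonglongrightarrow> integral\<^sup>L \<mu> \<phi>"
proof -
  define E where "E n = distr (M n) borel (\<lambda>x. x :: real)" for n
  have id: "(\<lambda>x. x) \<in> borel_measurable (M n)" for n
    using M[of n] unfolding torus_probs_def torus_def
    by (auto cong: measurable_cong_sets intro: measurable_restrict_space1)
  have pM: "prob_space (M n)" for n using M[of n] by (simp add: torus_probs_def)
  have rE: "real_distribution (E n)" for n
    unfolding E_def by (rule prob_space.real_distribution_distr[OF pM id])
  have "tight E"
    unfolding tight_def
  proof (intro conjI allI impI rE)
    fix \<epsilon> :: real assume "\<epsilon> > 0"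
    \<comment> \<open>Tightness is automatic, since all mass lies in \<open>{0..<1}\<close>.\<close>
    have "measure (E n) {-1<..1} = 1" for n
    proof -
      have "measure (E n) {-1<..1} = measure (M n) (space (M n))"
        unfolding E_def by (subst measure_distr[OF id]) (auto simp: space_torus_probs[OF M] intro!: arg_cong[where f="measure (M n)"])
      then show ?thesis using prob_space.prob_space[OF pM] by simp
    qed
    then show "\<exists>a b. a < b \<and> (\<forall>n. 1 - \<epsilon> < measure (E n) {a<..b})"
      using \<open>\<epsilon> > 0\<close> by (intro exI[of _ "-1"] exI[of _ 1]) auto
  qed
  from tight_imp_convergent_subsubsequence[OF this strict_mono_id] obtain r L
    where r: "strict_mono r" and L: "real_distribution L" "weak_conv_m (E \<circ> id \<circ> r) L" by blast
  interpret L: real_distribution L by (rule L(1))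
  have fr: "frac \<in> measurable L torus"
    using frac_measurable_torus by (simp cong: measurable_cong_sets)
  define \<mu> where "\<mu> = distr L torus frac"
  show ?thesis
  proof (rule that)
    show "\<mu> \<in> torus_probs"
      unfolding torus_probs_def \<mu>_def using L.prob_space_distr[OF fr] by simp
    fix \<phi> assume \<phi>: "torus_continuous \<phi>"
    note meas = torus_continuous_borel_measurable[OF \<phi>]
    obtain B where B: "\<And>x. \<bar>\<phi> (frac x)\<bar> \<le> B"
      using torus_continuous_bounded[OF \<phi>] by blast
    have "(\<lambda>n. integral\<^sup>L ((E \<circ> id \<circ> r) n) (\<lambda>x. \<phi> (frac x))) \<longlonglongrightarrow> integral\<^sup>L L (\<lambda>x. \<phi> (frac x))"
    proof (rule weak_conv_imp_integral_bdd_continuous_conv[OF _ L])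
      show "isCont (\<lambda>x. \<phi> (frac x)) x" for x
        using \<phi> by (simp add: torus_continuous_def continuous_on_eq_continuous_at)
    qed (use rE B in auto)
    moreover have "integral\<^sup>L (E n) (\<lambda>x. \<phi> (frac x)) = integral\<^sup>L (M n) \<phi>" for n
    proof -
      have "integral\<^sup>L (E n) (\<lambda>x. \<phi> (frac x)) = integral\<^sup>L (M n) (\<lambda>x. \<phi> (frac x))"
        unfolding E_def by (rule integral_distr[OF id meas(1)])
      also have "\<dots> = integral\<^sup>L (M n) \<phi>"
        by (rule Bochner_Integration.integral_cong) (auto simp: space_torus_probs[OF M] frac_eq)
      finally show ?thesis .
    qed
    moreover have "integral\<^sup>L \<mu> \<phi> = integral\<^sup>L L (\<lambda>x. \<phi> (frac x))"
      unfolding \<mu>_def by (rule integral_distr[OF fr meas(2)])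
    ultimately have sub: "(\<lambda>n. integral\<^sup>L (M (r n)) \<phi>) \<longlonglongrightarrow> integral\<^sup>L \<mu> \<phi>" by simp
    \<comment> \<open>Helly selection controls a subsequence only; the assumed convergence of the
      integrals extends the limit to the full sequence.\<close>
    from conv[OF \<phi>] obtain l where l: "(\<lambda>n. integral\<^sup>L (M n) \<phi>) \<longlonglongrightarrow> l"
      by (auto simp: convergent_def)
    have "l = integral\<^sup>L \<mu> \<phi>"
      using LIMSEQ_unique[OF LIMSEQ_subseq_LIMSEQ[OF l r]] sub by (simp add: o_def)
    then show "(\<lambda>n. integral\<^sup>L (M n) \<phi>) \<longlonglongrightarrow> integral\<^sup>L \<mu> \<phi>" using l by simp
  qed
qed

section \<open>Vectors and matrices\<close>

lemma index_mult_mat_unit_vec: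
  fixes A :: "'a :: comm_ring_1 mat"
  assumes "A \<in> carrier_mat n m" "i < n" "j < m"
  shows "(A *\<^sub>v unit_vec m j) $ i = A $$ (i, j)"
  using assms by (simp add: scalar_prod_right_unit)

lemma eq_mat_by_mult_vec:
  fixes A B :: "'a :: comm_ring_1 mat"
  assumes A: "A \<in> carrier_mat n m" and B: "B \<in> carrier_mat n m"
    and eq: "\<And>x. x \<in> carrier_vec m \<Longrightarrow> A *\<^sub>v x = B *\<^sub>v x"
  shows "A = B"
proof (rule eq_matI)
  fix i j assume ij: "i < dim_row B" "j < dim_col B"
  have "(A *\<^sub>v unit_vec m j) $ i = (B *\<^sub>v unit_vec m j) $ i"
    using eq[of "unit_vec m j"] by simp
  then show "A $$ (i, j) = B $$ (i, j)"
    using A B ij by (auto simp: scalar_prod_right_unit)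
qed (use A B in auto)

lemma vec_minus_eq_zeroD:
  fixes x y :: "'a :: ab_group_add Matrix.vec"
  assumes "x \<in> carrier_vec d" "y \<in> carrier_vec d" "x - y = 0\<^sub>v d"
  shows "x = y"
proof (rule eq_vecI)
  fix i assume "i < dim_vec y"
  then have i: "i < dim_vec y" "i < d" using assms by auto
  have "(x - y) $ i = 0" using i by (simp add: assms(3))
  then show "x $ i = y $ i" unfolding index_minus_vec(1)[OF i(1)] by simp
qed (use assms in auto)

lemma vec_add_minus_cancel:
  fixes x y :: "'a :: ab_group_add Matrix.vec"
  assumes "x \<in> carrier_vec d" "y \<in> carrier_vec d"
  shows "x + (y - x) = y"
  using assms by (intro eq_vecI) auto

lemma scalar_prod_self_ge_index:
  fixes x :: "real Matrix.vec"
  assumes "x \<in> carrier_vec d" "i < d"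
  shows "(x $ i)\<^sup>2 \<le> scalar_prod x x"
proof -
  have "(x $ i)\<^sup>2 \<le> (\<Sum>j\<in>{0..<d}. (x $ j)\<^sup>2)"
    using assms by (intro member_le_sum) auto
  then show ?thesis using assms by (simp add: scalar_prod_def power2_eq_square)
qed

lemma scalar_prod_self_nonneg: "0 \<le> scalar_prod x (x :: real Matrix.vec)"
  by (simp add: scalar_prod_def sum_nonneg)

lemma scalar_prod_self_eq_0:
  fixes x :: "real Matrix.vec"
  assumes "x \<in> carrier_vec d" "scalar_prod x x = 0"
  shows "x = 0\<^sub>v d"
proof (rule eq_vecI)
  fix i assume "i < dim_vec (0\<^sub>v d :: real Matrix.vec)"
  then show "x $ i = 0\<^sub>v d $ i"
    using scalar_prod_self_ge_index[of x d i] assms by auto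
qed (use assms in auto)

section \<open>Orthogonal projections\<close>

text \<open>A bare list of closure conditions, so that it applies equally to a span and to a subset
  cut out by a property, as in \<open>W_closed_transpose\<close>.\<close>

locale vec_subspace =
  fixes d :: nat and V :: "real Matrix.vec set"
  assumes subset: "V \<subseteq> carrier_vec d"
    and zero: "0\<^sub>v d \<in> V"
    and add: "x \<in> V \<Longrightarrow> y \<in> V \<Longrightarrow> x + y \<in> V"
    and smult: "x \<in> V \<Longrightarrow> c \<cdot>\<^sub>v x \<in> V"
begin

lemma carrier: "x \<in> V \<Longrightarrow> x \<in> carrier_vec d"
  using subset by auto

lemma minus: "x \<in> V \<Longrightarrow> y \<in> V \<Longrightarrow> x - y \<in> V"
proof -
  assume x: "x \<in> V" and y: "y \<in> V"
  have "x - y = x + (-1) \<cdot>\<^sub>v y" using carrier[OF x] carrier[OF y] by (intro eq_vecI) auto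
  then show ?thesis using add[OF x smult[OF y]] by simp
qed

text \<open>A symmetric idempotent whose range lies inside \<open>V\<close> but need not exhaust it:
  a partial projection, to be enlarged one dimension at a time.\<close>

definition is_proj :: "real mat \<Rightarrow> bool" where
  "is_proj P \<longleftrightarrow> P \<in> carrier_mat d d \<and> (\<forall>x\<in>carrier_vec d. P *\<^sub>v x \<in> V) \<and>
     (\<forall>x\<in>carrier_vec d. P *\<^sub>v (P *\<^sub>v x) = P *\<^sub>v x) \<and>
     (\<forall>x\<in>carrier_vec d. \<forall>y\<in>carrier_vec d. scalar_prod (P *\<^sub>v x) y = scalar_prod x (P *\<^sub>v y))"

lemma is_projD:
  assumes "is_proj P"
  shows "P \<in> carrier_mat d d" "P *\<^sub>v x \<in> carrier_vec d"
    and "x \<in> carrier_vec d \<Longrightarrow> P *\<^sub>v x \<in> V"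
    and "x \<in> carrier_vec d \<Longrightarrow> P *\<^sub>v (P *\<^sub>v x) = P *\<^sub>v x"
    and "x \<in> carrier_vec d \<Longrightarrow> y \<in> carrier_vec d \<Longrightarrow> scalar_prod (P *\<^sub>v x) y = scalar_prod x (P *\<^sub>v y)"
  using assms unfolding is_proj_def by (auto intro: carrier_vecI)

text \<open>By symmetry and idempotence the diagonal entry \<open>p\<close> is the squared length of
  the image of a unit vector, and \<open>p\<close> is also one of the coordinates of that image;
  hence \<open>p\<^sup>2 \<le> p\<close>. This bounds the trace by \<open>d\<close>.\<close>

lemma is_proj_diag_le_1:
  assumes "is_proj P" "i < d"
  shows "P $$ (i, i) \<le> 1"
proof -
  note P = is_projD[OF assms(1)]
  let ?e = "unit_vec d i :: real Matrix.vec"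
  note Pe = P(2)[of ?e]
  have idx: "(P *\<^sub>v ?e) $ i = P $$ (i, i)"
    using P(1) assms(2) by (auto simp: scalar_prod_right_unit)
  have "P $$ (i, i) = scalar_prod ?e (P *\<^sub>v ?e)"
    using scalar_prod_left_unit[OF Pe assms(2)] idx by simp
  also have "\<dots> = scalar_prod ?e (P *\<^sub>v (P *\<^sub>v ?e))"
    by (simp only: P(4)[OF unit_vec_carrier])
  also have "\<dots> = scalar_prod (P *\<^sub>v ?e) (P *\<^sub>v ?e)"
    by (rule P(5)[symmetric]) (simp_all only: Pe unit_vec_carrier)
  finally have "(P $$ (i, i))\<^sup>2 \<le> P $$ (i, i)"
    using scalar_prod_self_ge_index[OF Pe assms(2)] idx by simp
  show ?thesis
  proof (rule ccontr)
    assume "\<not> ?thesis"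
    then have "P $$ (i, i) * 1 < P $$ (i, i) * P $$ (i, i)"
      by (intro mult_strict_left_mono) auto
    then show False using \<open>(P $$ (i, i))\<^sup>2 \<le> P $$ (i, i)\<close> by (simp add: power2_eq_square)
  qed
qed

text \<open>One Gram-Schmidt step: \<open>w - P *\<^sub>v w\<close> is orthogonal to the range of
  \<open>P\<close>, and with its normalisation \<open>e\<close> the rank-one matrix with entries
  \<open>e $ i * e $ j\<close> is added to \<open>P\<close>. The trace grows by
  \<open>scalar_prod e e = 1\<close>.\<close>

lemma is_proj_extend:
  assumes P: "is_proj P" and w: "w \<in> V" "P *\<^sub>v w \<noteq> w"
  obtains P' where "is_proj P'" "(\<Sum>i<d. P' $$ (i, i)) = (\<Sum>i<d. P $$ (i, i)) + 1"
proof -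
  note Pc = is_projD[OF P]
  note PC = Pc(1) and Px[simp, intro] = Pc(2)
  have wC[simp]: "w \<in> carrier_vec d" using w carrier by auto
  define q where "q = w - P *\<^sub>v w"
  have qC[simp]: "q \<in> carrier_vec d" by (auto simp: q_def)
  have qV: "q \<in> V" unfolding q_def by (intro minus w Pc(3) wC)
  have Pq: "P *\<^sub>v q = 0\<^sub>v d"
  proof -
    have "P *\<^sub>v q = P *\<^sub>v w - P *\<^sub>v (P *\<^sub>v w)"
      unfolding q_def by (rule mult_minus_distrib_mat_vec[OF PC]) auto
    then show ?thesis by (simp add: Pc(4))
  qed
  have "q \<noteq> 0\<^sub>v d"
  proof
    assume "q = 0\<^sub>v d"
    then show False using vec_minus_eq_zeroD[OF wC Px[of w]] w by (simp add: q_def)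
  qed
  then have q0: "scalar_prod q q > 0"
    using scalar_prod_self_eq_0[OF qC] scalar_prod_self_nonneg[of q] by fastforce
  define e where "e = (1 / sqrt (scalar_prod q q)) \<cdot>\<^sub>v q"
  have eC[simp]: "e \<in> carrier_vec d" and eV: "e \<in> V"
    using smult[OF qV] by (auto simp: e_def)
  have ee: "scalar_prod e e = 1"
    using q0 by (simp add: e_def scalar_prod_smult_left[OF ] scalar_prod_smult_right)
  have Pe: "P *\<^sub>v e = 0\<^sub>v d"
    unfolding e_def using mult_mat_vec[OF PC qC] Pq by (auto intro!: eq_vecI)
  define P' where "P' = Matrix.mat d d (\<lambda>(i, j). P $$ (i, j) + e $ i * e $ j)"
  have P'C: "P' \<in> carrier_mat d d" by (simp add: P'_def)
  have P'x: "P' *\<^sub>v x = P *\<^sub>v x + scalar_prod e x \<cdot>\<^sub>v e" if "x \<in> carrier_vec d" for x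
  proof (rule eq_vecI)
    fix i assume "i < dim_vec (P *\<^sub>v x + scalar_prod e x \<cdot>\<^sub>v e)"
    then have i: "i < d" using eC by auto
    have e: "dim_vec e = d" using eC by (rule carrier_vecD)
    have "(P *\<^sub>v x + scalar_prod e x \<cdot>\<^sub>v e) $ i = (P *\<^sub>v x) $ i + scalar_prod e x * e $ i"
    proof -
      have "i < dim_vec e" "i < dim_vec (scalar_prod e x \<cdot>\<^sub>v e)"
        using i unfolding index_smult_vec(2) e by simp_all
      then show ?thesis by (simp only: index_add_vec(1) index_smult_vec(1))
    qed
    moreover have "(P' *\<^sub>v x) $ i = (P *\<^sub>v x) $ i + scalar_prod e x * e $ i"
      using that PC i e
      by (auto simp: P'_def scalar_prod_def algebra_simps sum.distrib sum_distrib_left)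
    ultimately show "(P' *\<^sub>v x) $ i = (P *\<^sub>v x + scalar_prod e x \<cdot>\<^sub>v e) $ i" by (simp only:)
  qed (simp only: dim_mult_mat_vec index_add_vec(2) index_smult_vec(2) carrier_matD(1)[OF P'C] carrier_vecD[OF eC])
  have eP: "scalar_prod e (P *\<^sub>v x) = 0" if "x \<in> carrier_vec d" for x
    using Pc(5)[OF eC that] that by (simp add: Pe)
  have "is_proj P'"
    unfolding is_proj_def
  proof (intro conjI ballI P'C)
    fix x :: "real Matrix.vec" assume x: "x \<in> carrier_vec d"
    show "P' *\<^sub>v x \<in> V"
      unfolding P'x[OF x] by (intro add smult eV Pc(3) x)
    define c where "c = scalar_prod e x"
    have "P' *\<^sub>v (P' *\<^sub>v x) = P *\<^sub>v (P *\<^sub>v x + c \<cdot>\<^sub>v e) + scalar_prod e (P *\<^sub>v x + c \<cdot>\<^sub>v e) \<cdot>\<^sub>v e"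
      unfolding P'x[OF x] c_def by (rule P'x) simp
    also have "P *\<^sub>v (P *\<^sub>v x + c \<cdot>\<^sub>v e) = P *\<^sub>v x"
    proof -
      have "c \<cdot>\<^sub>v 0\<^sub>v d = 0\<^sub>v d" by (intro eq_vecI) auto
      then show ?thesis
        by (simp add: mult_add_distrib_mat_vec[OF PC] mult_mat_vec[OF PC] Pe Pc(4)[OF x])
    qed
    also have "scalar_prod e (P *\<^sub>v x + c \<cdot>\<^sub>v e) = c"
      using eP[OF x] ee by (simp add: scalar_prod_add_distrib[OF eC] )
    finally show "P' *\<^sub>v (P' *\<^sub>v x) = P' *\<^sub>v x"
      by (simp add: P'x[OF x] c_def)
    fix y :: "real Matrix.vec" assume y: "y \<in> carrier_vec d"
    have "scalar_prod (P' *\<^sub>v x) y = scalar_prod (P *\<^sub>v x) y + scalar_prod e x * scalar_prod e y"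
      unfolding P'x[OF x] by (subst add_scalar_prod_distrib[OF _ _ y]) (use y in auto)
    also have "\<dots> = scalar_prod x (P' *\<^sub>v y)"
      unfolding P'x[OF y] using x y
      by (subst scalar_prod_add_distrib[OF x]) (simp_all add: Pc(5) comm_scalar_prod[OF x eC])
    finally show "scalar_prod (P' *\<^sub>v x) y = scalar_prod x (P' *\<^sub>v y)" .
  qed
  moreover have "(\<Sum>i<d. P' $$ (i, i)) = (\<Sum>i<d. P $$ (i, i)) + scalar_prod e e"
    using carrier_vecD[OF eC] by (simp only: P'_def sum.distrib scalar_prod_def lessThan_atLeast0)
      (simp add: sum.distrib)
  ultimately show ?thesis using that ee by simp
qed

lemma zero_mat_mult_vec: "x \<in> carrier_vec d \<Longrightarrow> 0\<^sub>m d d *\<^sub>v x = (0\<^sub>v d :: real Matrix.vec)"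
  by (intro eq_vecI) auto

text \<open>The trace stands in for the dimension of the range. It starts at 0, grows in steps of 1
  and is at most \<open>d\<close>, so a partial projection of maximal trace exists; a vector of
  \<open>V\<close> that it does not fix would allow a further extension.\<close>

lemma complete_proj_exists: "\<exists>P. is_proj P \<and> (\<forall>w\<in>V. P *\<^sub>v w = w)"
proof -
  let ?Q = "\<lambda>n. \<exists>P. is_proj P \<and> (\<Sum>i<d. P $$ (i, i)) = real n"
  have "is_proj (0\<^sub>m d d)"
    unfolding is_proj_def using zero zero_mat_mult_vec by simp
  then have "?Q 0" by (intro exI[of _ "0\<^sub>m d d"]) auto
  moreover have "n \<le> d" if "?Q n" for n
  proof -
    from that obtain P where P: "is_proj P" "(\<Sum>i<d. P $$ (i, i)) = real n" by auto
    have "real n \<le> (\<Sum>i<d. 1)"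
      unfolding P(2)[symmetric] by (intro sum_mono is_proj_diag_le_1[OF P(1)]) auto
    then show ?thesis by simp
  qed
  ultimately obtain n where n: "?Q n" "\<And>m. ?Q m \<Longrightarrow> m \<le> n"
    using GreatestI_nat[of ?Q 0 d] Greatest_le_nat[of ?Q _ d] by blast
  from n(1) obtain P where P: "is_proj P" "(\<Sum>i<d. P $$ (i, i)) = real n" by auto
  have "P *\<^sub>v w = w" if wV: "w \<in> V" for w
  proof (rule ccontr)
    assume "P *\<^sub>v w \<noteq> w"
    then obtain P' where P': "is_proj P'" "(\<Sum>i<d. P' $$ (i, i)) = (\<Sum>i<d. P $$ (i, i)) + 1"
      by (rule is_proj_extend[OF P(1) wV])
    then have "?Q (Suc n)" using P(2) by (intro exI[of _ P']) simp
    then have "Suc n \<le> n" by (rule n(2))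
    then show False by simp
  qed
  with P show ?thesis by auto
qed

lemma orth_compl_self: "x \<in> V \<Longrightarrow> x \<in> orth_compl d V \<Longrightarrow> x = 0\<^sub>v d"
  by (rule scalar_prod_self_eq_0) (auto simp: orth_compl_def)

text \<open>Justifies the \<open>THE\<close> in the definition. Existence is
  \<open>complete_proj_exists\<close>; two candidates agree because the difference of their values
  lies both in \<open>V\<close> and in its orthogonal complement.\<close>

lemma orth_proj:
  shows orth_proj_carrier: "orth_proj d V \<in> carrier_mat d d"
    and orth_proj_in: "x \<in> carrier_vec d \<Longrightarrow> orth_proj d V *\<^sub>v x \<in> V"
    and orth_proj_compl: "x \<in> carrier_vec d \<Longrightarrow> x - orth_proj d V *\<^sub>v x \<in> orth_compl d V"
proof -
  let ?R = "\<lambda>P. P \<in> carrier_mat d d \<and>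
     (\<forall>x\<in>carrier_vec d. P *\<^sub>v x \<in> V \<and> x - P *\<^sub>v x \<in> orth_compl d V)"
  from complete_proj_exists obtain P where P: "is_proj P" "\<And>w. w \<in> V \<Longrightarrow> P *\<^sub>v w = w" by auto
  note Pc = is_projD[OF P(1)]
  have "?R P"
  proof (intro conjI ballI)
    fix x :: "real Matrix.vec" assume x: "x \<in> carrier_vec d"
    note PC = Pc(2)[of x]
    show "x - P *\<^sub>v x \<in> orth_compl d V"
      unfolding orth_compl_def
    proof (intro CollectI conjI ballI)
      fix w assume w: "w \<in> V"
      have "scalar_prod (x - P *\<^sub>v x) w = scalar_prod x w - scalar_prod (P *\<^sub>v x) w"
        by (rule minus_scalar_prod_distrib[OF x PC carrier[OF w]])
      also have "scalar_prod (P *\<^sub>v x) w = scalar_prod x (P *\<^sub>v w)"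
        by (rule Pc(5)[OF x carrier[OF w]])
      finally show "scalar_prod (x - P *\<^sub>v x) w = 0" using P(2)[OF w] by simp
    qed (use x PC in simp)
  qed (use Pc in simp_all)
  moreover have "Q = P" if Q: "?R Q" for Q
  proof (rule eq_mat_by_mult_vec)
    fix x :: "real Matrix.vec" assume x: "x \<in> carrier_vec d"
    let ?y = "P *\<^sub>v x" let ?z = "Q *\<^sub>v x"
    have yz: "?y \<in> V" "?z \<in> V" "x - ?y \<in> orth_compl d V" "x - ?z \<in> orth_compl d V"
      using Q \<open>?R P\<close> x by auto
    note c = carrier[OF yz(1)] carrier[OF yz(2)]
    have "?y - ?z \<in> orth_compl d V"
      unfolding orth_compl_def
    proof (intro CollectI conjI ballI)
      fix w assume w: "w \<in> V"
      have "scalar_prod (x - ?y) w = 0" "scalar_prod (x - ?z) w = 0"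
        using yz w by (auto simp: orth_compl_def)
      then show "scalar_prod (?y - ?z) w = 0"
        using minus_scalar_prod_distrib[OF x c(1) carrier[OF w]] minus_scalar_prod_distrib[OF x c(2) carrier[OF w]]
          minus_scalar_prod_distrib[OF c carrier[OF w]] by simp
    qed (use c in auto)
    then have "?y - ?z = 0\<^sub>v d" using minus[OF yz(1,2)] by (intro orth_compl_self)
    then show "?z = ?y" using vec_minus_eq_zeroD[OF c] by simp
  qed (use Q Pc(1) in simp_all)
  ultimately have "?R (orth_proj d V)"
    unfolding orth_proj_def by (intro theI[of ?R P])
  then show "orth_proj d V \<in> carrier_mat d d"
    "x \<in> carrier_vec d \<Longrightarrow> orth_proj d V *\<^sub>v x \<in> V"
    "x \<in> carrier_vec d \<Longrightarrow> x - orth_proj d V *\<^sub>v x \<in> orth_compl d V" by auto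
qed

lemma orth_proj_vec_carrier: "orth_proj d V *\<^sub>v x \<in> carrier_vec d"
  using orth_proj_carrier by (auto intro: carrier_vecI)

text \<open>Vectors of \<open>V\<close> do not see the orthogonal part, so projections may be
  inserted or removed in front of them.\<close>

lemma scalar_prod_orth_proj:
  assumes w: "w \<in> V" and x: "x \<in> carrier_vec d"
  shows "scalar_prod w (orth_proj d V *\<^sub>v x) = scalar_prod w x"
proof -
  have "scalar_prod (x - orth_proj d V *\<^sub>v x) w = 0"
    using orth_proj_compl[OF x] w by (auto simp: orth_compl_def)
  then have "scalar_prod x w = scalar_prod (orth_proj d V *\<^sub>v x) w"
    using minus_scalar_prod_distrib[OF x orth_proj_vec_carrier carrier[OF w]] by simp
  then show ?thesis
    using comm_scalar_prod[OF x carrier[OF w]] comm_scalar_prod[OF orth_proj_vec_carrier carrier[OF w]] by simp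
qed

lemma orth_proj_id:
  assumes w: "w \<in> V"
  shows "orth_proj d V *\<^sub>v w = w"
proof -
  note c = carrier[OF w]
  have "w - orth_proj d V *\<^sub>v w = 0\<^sub>v d"
    using orth_proj_compl[OF c] minus[OF w orth_proj_in[OF c]] by (intro orth_compl_self)
  then show ?thesis by (rule vec_minus_eq_zeroD[OF c orth_proj_vec_carrier, symmetric])
qed

lemma orth_proj_idem: "orth_proj d V * orth_proj d V = orth_proj d V"
proof (rule eq_mat_by_mult_vec)
  fix x :: "real Matrix.vec" assume x: "x \<in> carrier_vec d"
  show "orth_proj d V * orth_proj d V *\<^sub>v x = orth_proj d V *\<^sub>v x"
    using orth_proj_id[OF orth_proj_in[OF x]] assoc_mult_mat_vec[OF orth_proj_carrier orth_proj_carrier x] by simp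
qed (use orth_proj_carrier in auto)

end

section \<open>Generalised eigenspaces\<close>

text \<open>What remains of the block structure when positions are not assigned to blocks: the
  matrix is upper bidiagonal, and a nonzero superdiagonal entry joins two positions with the same
  eigenvalue.\<close>

lemma jordan_matrix_offdiag:
  fixes n_as :: "(nat \<times> 'a :: {zero, one}) list"
  defines "J \<equiv> jordan_matrix n_as"
  assumes "i < sum_list (map fst n_as)" "j < sum_list (map fst n_as)"
  shows "i \<noteq> j \<Longrightarrow> Suc i \<noteq> j \<Longrightarrow> J $$ (i, j) = 0"
    and "Suc i = j \<Longrightarrow> J $$ (i, j) = 0 \<or> J $$ (i, i) = J $$ (j, j)"
proof -
  have "(i \<noteq> j \<longrightarrow> Suc i \<noteq> j \<longrightarrow> jordan_matrix n_as $$ (i, j) = 0) \<and>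
    (Suc i = j \<longrightarrow> jordan_matrix n_as $$ (i, j) = 0 \<or> jordan_matrix n_as $$ (i, i) = jordan_matrix n_as $$ (j, j))"
    using assms(2,3)
  proof (induction n_as arbitrary: i j)
    case (Cons na n_as)
    obtain n a where na: "na = (n, a)" by force
    show ?case
    proof (cases "i < n \<or> j < n")
      case True
      then show ?thesis using Cons.prems unfolding na by (auto simp: jordan_matrix_Cons)
    next
      case False
      then show ?thesis
        using Cons.IH[of "i - n" "j - n"] Cons.prems unfolding na
        by (auto simp: jordan_matrix_Cons Suc_diff_le)
    qed
  qed simp
  then show "i \<noteq> j \<Longrightarrow> Suc i \<noteq> j \<Longrightarrow> J $$ (i, j) = 0"
    and "Suc i = j \<Longrightarrow> J $$ (i, j) = 0 \<or> J $$ (i, i) = J $$ (j, j)"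
    by (auto simp: J_def)
qed

text \<open>Subtracting the eigenvalue sends each basis vector to a multiple of its predecessor, and
  the multiple is nonzero only if the predecessor belongs to the same eigenvalue. The exponent
  \<open>Suc i\<close> counts down to the first row of the whole matrix, which is enough without
  locating the block.\<close>

lemma jordan_matrix_unit_vec:
  fixes n_as :: "(nat \<times> 'a :: field) list"
  defines "J \<equiv> jordan_matrix n_as" and "n \<equiv> sum_list (map fst n_as)"
  assumes "i < n"
  shows "(char_matrix J (J $$ (i, i)) ^\<^sub>m Suc i) *\<^sub>v unit_vec n i = 0\<^sub>v n"
  using assms(3)
proof (induction i)
  case i: 0
  let ?C = "char_matrix J (J $$ (0, 0))"
  have J: "J \<in> carrier_mat n n" by (simp add: J_def n_def)
  have C: "?C \<in> carrier_mat n n" by (rule char_matrix_closed[OF J])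
  have "?C *\<^sub>v unit_vec n 0 = 0\<^sub>v n"
  proof (rule eq_vecI)
    fix j assume "j < dim_vec (0\<^sub>v n :: 'a Matrix.vec)"
    then have j: "j < n" by simp
    then have "(?C *\<^sub>v unit_vec n 0) $ j = ?C $$ (j, 0)"
      using i C by (simp add: scalar_prod_right_unit)
    also have "\<dots> = 0"
      using jordan_matrix_offdiag(1)[of j n_as 0] i j J
      by (auto simp: char_matrix_def J_def n_def)
    finally show "(?C *\<^sub>v unit_vec n 0) $ j = 0\<^sub>v n $ j" using j by simp
  qed (use C in simp)
  then show ?case using C by simp
next
  case (Suc i)
  let ?z = "J $$ (Suc i, Suc i)"
  let ?C = "char_matrix J ?z"
  have J: "J \<in> carrier_mat n n" by (simp add: J_def n_def)
  have C: "?C \<in> carrier_mat n n" by (rule char_matrix_closed[OF J])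
  have Cp: "?C ^\<^sub>m m \<in> carrier_mat n n" for m using C by simp
  define b where "b = J $$ (i, Suc i)"
  have Cu: "?C *\<^sub>v unit_vec n (Suc i) = b \<cdot>\<^sub>v unit_vec n i"
  proof (rule eq_vecI)
    fix j assume "j < dim_vec (b \<cdot>\<^sub>v unit_vec n i)"
    then have j: "j < n" by simp
    then have "(?C *\<^sub>v unit_vec n (Suc i)) $ j = ?C $$ (j, Suc i)"
      using Suc.prems C by (simp add: scalar_prod_right_unit)
    also have "\<dots> = (if j = i then b else 0)"
      using jordan_matrix_offdiag(1)[of j n_as "Suc i"] Suc.prems j J
      by (auto simp: char_matrix_def J_def n_def b_def)
    finally show "(?C *\<^sub>v unit_vec n (Suc i)) $ j = (b \<cdot>\<^sub>v unit_vec n i) $ j" using j Suc.prems by simp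
  qed (use C in simp)
  have "(?C ^\<^sub>m Suc (Suc i)) *\<^sub>v unit_vec n (Suc i) = (?C ^\<^sub>m Suc i) *\<^sub>v (?C *\<^sub>v unit_vec n (Suc i))"
    unfolding pow_mat.simps(2)[of ?C "Suc i"] by (rule assoc_mult_mat_vec[OF Cp C]) simp
  also have "\<dots> = b \<cdot>\<^sub>v ((?C ^\<^sub>m Suc i) *\<^sub>v unit_vec n i)"
    unfolding Cu by (rule mult_mat_vec[OF Cp]) simp
  also have "\<dots> = 0\<^sub>v n"
  proof (cases "b = 0")
    case True
    then show ?thesis using Cp[of "Suc i"] by (auto intro!: eq_vecI simp del: pow_mat.simps)
  next
    case False
    then have "J $$ (i, i) = ?z"
      using jordan_matrix_offdiag(2)[of i n_as "Suc i"] Suc.prems by (auto simp: b_def J_def n_def)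
    then show ?thesis using Suc by auto
  qed
  finally show ?case .
qed

lemma gen_eigenspace_carrier:
  assumes M: "M \<in> carrier_mat n n" and x: "x \<in> gen_eigenspace M z"
  shows "x \<in> carrier_vec n"
proof -
  from x obtain m where "x \<in> mat_kernel (char_matrix M z ^\<^sub>m m)" by (auto simp: gen_eigenspace_def)
  then show ?thesis
    by (rule mat_kernelD(1)[rotated]) (use M in \<open>auto intro: pow_carrier_mat\<close>)
qed

text \<open>A spanning statement in the form in which it is applied. The columns of the transition
  matrix \<open>S\<close> to Jordan form are generalised eigenvectors, so \<open>D * S = 0\<close>,
  and \<open>S\<close> is invertible.\<close>

lemma gen_eigenspaces_total:
  assumes M: "M \<in> carrier_mat n n" and D: "D \<in> carrier_mat n n"
    and kill: "\<And>z x. x \<in> gen_eigenspace M z \<Longrightarrow> D *\<^sub>v x = 0\<^sub>v n"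
  shows "D = 0\<^sub>m n n"
proof -
  obtain as where "char_poly M = (\<Prod>a\<leftarrow>as. [:- a, 1:])" using char_poly_factorized[OF M] by auto
  then obtain n_as where "jordan_nf M n_as" using jordan_nf_exists[OF M] by auto
  then obtain S T where wit: "similar_mat_wit M (jordan_matrix n_as) S T"
    unfolding jordan_nf_def similar_mat_def by auto
  define J where "J = jordan_matrix n_as"
  note w = similar_mat_witD2[OF M wit, folded J_def]
  have n: "n = sum_list (map fst n_as)" using carrier_matD(1)[OF w(5)] by (simp add: J_def)
  have "D * S = 0\<^sub>m n n"
  proof (rule eq_matI)
    fix j i assume "j < dim_row (0\<^sub>m n n :: complex mat)" "i < dim_col (0\<^sub>m n n :: complex mat)"
    then have i: "i < n" and j: "j < n" by auto
    let ?z = "J $$ (i, i)" let ?u = "unit_vec n i :: complex Matrix.vec"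
    let ?CM = "char_matrix M ?z ^\<^sub>m Suc i" let ?CJ = "char_matrix J ?z ^\<^sub>m Suc i"
    have CM: "?CM \<in> carrier_mat n n" and CJ: "?CJ \<in> carrier_mat n n"
      using char_matrix_closed[OF M] char_matrix_closed[OF w(5)] by (auto intro!: pow_carrier_mat simp del: pow_mat.simps)
    have "?CM = S * ?CJ * T"
      by (rule similar_mat_wit_pow_id[OF similar_mat_wit_char_matrix[OF wit[folded J_def]]])
    then have "?CM *\<^sub>v (S *\<^sub>v ?u) = (S * ?CJ * T) *\<^sub>v (S *\<^sub>v ?u)" by (simp only:)
    also have "\<dots> = (S * ?CJ) *\<^sub>v (T *\<^sub>v (S *\<^sub>v ?u))"
      by (rule assoc_mult_mat_vec[OF mult_carrier_mat[OF w(6) CJ] w(7) mult_mat_vec_carrier[OF w(6) unit_vec_carrier]])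
    also have "T *\<^sub>v (S *\<^sub>v ?u) = (T * S) *\<^sub>v ?u"
      by (rule assoc_mult_mat_vec[OF w(7,6) unit_vec_carrier, symmetric])
    also have "\<dots> = ?u" using w(2) by simp
    also have "(S * ?CJ) *\<^sub>v ?u = S *\<^sub>v (?CJ *\<^sub>v ?u)"
      by (rule assoc_mult_mat_vec[OF w(6) CJ unit_vec_carrier])
    also have "?CJ *\<^sub>v ?u = 0\<^sub>v n"
      using jordan_matrix_unit_vec[of i n_as] i n J_def by simp
    also have "S *\<^sub>v 0\<^sub>v n = 0\<^sub>v n" using w(6) by auto
    finally have "S *\<^sub>v ?u \<in> mat_kernel ?CM"
      using w(6) CM by (intro mat_kernelI) auto
    then have "D *\<^sub>v (S *\<^sub>v ?u) = 0\<^sub>v n"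
      by (intro kill[of _ ?z]) (auto simp: gen_eigenspace_def simp del: pow_mat.simps)
    then have "(D * S) *\<^sub>v ?u = 0\<^sub>v n"
      by (simp only: assoc_mult_mat_vec[OF D w(6) unit_vec_carrier])
    then have "((D * S) *\<^sub>v ?u) $ j = 0" using j by simp
    then show "(D * S) $$ (j, i) = 0\<^sub>m n n $$ (j, i)"
      using index_mult_mat_unit_vec[OF mult_carrier_mat[OF D w(6)] j i] i j by simp
  qed (use D w in auto)
  then have "(D * S) * T = 0\<^sub>m n n" using w(7) by simp
  also have "(D * S) * T = D * (S * T)" by (rule assoc_mult_mat[OF D w(6,7)])
  also have "\<dots> = D" using w(1) D by simp
  finally show ?thesis .
qed

section \<open>Complexification and rotations with trivial phases\<close>

context vec_subspace
begin

definition cproj :: "complex mat" where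
  "cproj = map_mat complex_of_real (orth_proj d V)"

lemma cproj_carrier: "cproj \<in> carrier_mat d d"
  by (simp add: cproj_def orth_proj_carrier)

lemma Re_Im_cproj:
  assumes "x \<in> carrier_vec d"
  shows "map_vec Re (cproj *\<^sub>v x) = orth_proj d V *\<^sub>v map_vec Re x"
    and "map_vec Im (cproj *\<^sub>v x) = orth_proj d V *\<^sub>v map_vec Im x"
  using assms orth_proj_carrier
  by (auto intro!: eq_vecI simp: cproj_def scalar_prod_def)

lemma cproj_in_complexification:
  assumes x: "x \<in> carrier_vec d"
  shows "cproj *\<^sub>v x \<in> complexification d V"
  unfolding complexification_def
  using orth_proj_in[of "map_vec Re x"] orth_proj_in[of "map_vec Im x"] x cproj_carrier
  by (auto simp: Re_Im_cproj intro: carrier_vecI)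

lemma cproj_compl:
  assumes x: "x \<in> carrier_vec d"
  shows "x - cproj *\<^sub>v x \<in> complexification d (orth_compl d V)"
proof -
  have c: "cproj *\<^sub>v x \<in> carrier_vec d" using cproj_carrier by (auto intro: carrier_vecI)
  have "map_vec Re (x - cproj *\<^sub>v x) = map_vec Re x - map_vec Re (cproj *\<^sub>v x)"
    "map_vec Im (x - cproj *\<^sub>v x) = map_vec Im x - map_vec Im (cproj *\<^sub>v x)"
    using x c carrier_matD[OF cproj_carrier] by (auto intro!: eq_vecI simp del: index_mult_mat_vec)
  then show ?thesis
    unfolding complexification_def
    using orth_proj_compl[of "map_vec Re x"] orth_proj_compl[of "map_vec Im x"] x c
    by (auto simp: Re_Im_cproj)
qed

text \<open>The identity clearly satisfies the description; uniqueness is the point. As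
  \<open>cproj\<close> commutes with \<open>M\<close>, it maps generalised eigenvectors to
  generalised eigenvectors inside the complexified \<open>V\<close>, which a candidate
  \<open>R\<close> must fix. By \<open>gen_eigenspaces_total\<close>,
  \<open>R * cproj = cproj\<close>; on the orthogonal complement \<open>R\<close> acts trivially by
  assumption.\<close>

lemma rotation_mat_one:
  fixes T :: "real mat"
  assumes T: "T \<in> carrier_mat d d"
  defines "M \<equiv> map_mat complex_of_real (orth_proj d V * T * orth_proj d V)"
  shows "rotation_mat d V M (\<lambda>_. 1) = 1\<^sub>m d"
  unfolding rotation_mat_def
proof (rule the_equality)
  let ?P = "\<lambda>R. R \<in> carrier_mat d d \<and>
     (\<forall>z\<in>peripheral M. \<forall>x\<in>gen_eigenspace M z \<inter> complexification d V. R *\<^sub>v x = 1 \<cdot>\<^sub>v x) \<and>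
     (\<forall>z. z \<notin> peripheral M \<longrightarrow>
        (\<forall>x\<in>gen_eigenspace M z \<inter> complexification d V. R *\<^sub>v x = x)) \<and>
     (\<forall>x\<in>complexification d (orth_compl d V). R *\<^sub>v x = x)"
  note PC = orth_proj_carrier and cP = cproj_carrier
  have MC: "M \<in> carrier_mat d d" using PC T by (simp add: M_def)
  have "M * cproj = M" "cproj * M = M"
  proof -
    have "orth_proj d V * T * orth_proj d V * orth_proj d V = orth_proj d V * T * orth_proj d V"
      using PC T by (simp add: assoc_mult_mat[of _ d d _ d _ d] orth_proj_idem)
    then show "M * cproj = M"
      using PC T unfolding M_def cproj_def
      by (subst of_real_hom.mat_hom_mult[symmetric, of _ d d _ d]) auto
    have "orth_proj d V * (orth_proj d V * T * orth_proj d V) = orth_proj d V * orth_proj d V * T * orth_proj d V"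
      using PC T by (simp add: assoc_mult_mat[of _ d d _ d _ d])
    then have "orth_proj d V * (orth_proj d V * T * orth_proj d V) = orth_proj d V * T * orth_proj d V"
      by (simp add: orth_proj_idem)
    then show "cproj * M = M"
      using PC T unfolding M_def cproj_def
      by (subst of_real_hom.mat_hom_mult[symmetric, of _ d d _ d]) auto
  qed
  then have comm: "char_matrix M z * cproj = cproj * char_matrix M z" for z
    using MC cP unfolding char_matrix_def
    by (simp add: add_mult_distrib_mat[of _ d d _ _ d] mult_add_distrib_mat[of _ d d _ d]
        mult_smult_distrib[of _ d d _ d] mult_smult_assoc_mat[of _ d d _ d])
  show "?P (1\<^sub>m d)"
    by (auto simp: complexification_def)
  fix R assume R: "?P R"
  then have RC: "R \<in> carrier_mat d d" by blast
  have comm_pow: "char_matrix M z ^\<^sub>m m *\<^sub>v (cproj *\<^sub>v x) = cproj *\<^sub>v (char_matrix M z ^\<^sub>m m *\<^sub>v x)"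
    if "x \<in> carrier_vec d" for z m x
  proof -
    have "char_matrix M z ^\<^sub>m m * cproj = cproj * char_matrix M z ^\<^sub>m m"
    proof (induction m)
      case 0
      then show ?case using MC cP by (simp add: char_matrix_def)
    next
      case (Suc m)
      let ?C = "char_matrix M z"
      have C: "?C \<in> carrier_mat d d" by (rule char_matrix_closed[OF MC])
      then have Cp: "?C ^\<^sub>m m \<in> carrier_mat d d" by simp
      have "?C ^\<^sub>m Suc m * cproj = ?C ^\<^sub>m m * (?C * cproj)"
        using C Cp cP by (simp add: assoc_mult_mat[of _ d d _ d _ d])
      also have "\<dots> = ?C ^\<^sub>m m * cproj * ?C"
        using C Cp cP by (simp add: comm assoc_mult_mat[of _ d d _ d _ d])
      also have "\<dots> = cproj * (?C ^\<^sub>m m * ?C)"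
        using C Cp cP by (simp add: Suc assoc_mult_mat[of _ d d _ d _ d])
      finally show ?case by simp
    qed
    moreover have "char_matrix M z ^\<^sub>m m \<in> carrier_mat d d" using MC by (simp add: char_matrix_closed)
    ultimately show ?thesis
      using assoc_mult_mat_vec[of "char_matrix M z ^\<^sub>m m" d d cproj d x]
        assoc_mult_mat_vec[of cproj d d "char_matrix M z ^\<^sub>m m" d x] cP that by simp
  qed
  have "R * cproj - cproj = 0\<^sub>m d d"
  proof (rule gen_eigenspaces_total[OF MC])
    fix z x assume x: "x \<in> gen_eigenspace M z"
    then have xC: "x \<in> carrier_vec d" by (rule gen_eigenspace_carrier[OF MC])
    have PxC: "cproj *\<^sub>v x \<in> carrier_vec d" using cP by (auto intro: carrier_vecI)
    from x obtain m where m: "x \<in> mat_kernel (char_matrix M z ^\<^sub>m m)" by (auto simp: gen_eigenspace_def)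
    have C: "char_matrix M z ^\<^sub>m m \<in> carrier_mat d d" using MC by (simp add: char_matrix_closed)
    have "char_matrix M z ^\<^sub>m m *\<^sub>v (cproj *\<^sub>v x) = 0\<^sub>v d"
      unfolding comm_pow[OF xC] mat_kernelD(2)[OF C m] using cP by auto
    then have "cproj *\<^sub>v x \<in> gen_eigenspace M z"
      unfolding gen_eigenspace_def using mat_kernelI[OF C PxC] by auto
    then have "R *\<^sub>v (cproj *\<^sub>v x) = cproj *\<^sub>v x"
      using R cproj_in_complexification[OF xC] by (cases "z \<in> peripheral M") auto
    then have "(R * cproj) *\<^sub>v x = cproj *\<^sub>v x"
      using RC cP xC by simp
    then show "(R * cproj - cproj) *\<^sub>v x = 0\<^sub>v d"
      using RC cP xC PxC by (simp add: minus_mult_distrib_mat_vec[of _ d d])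
  qed (rule minus_carrier_mat[OF cP])
  show "R = 1\<^sub>m d"
  proof (rule eq_mat_by_mult_vec[OF RC])
    fix x :: "complex Matrix.vec" assume x: "x \<in> carrier_vec d"
    have PxC: "cproj *\<^sub>v x \<in> carrier_vec d" using cP by (auto intro: carrier_vecI)
    have "(R * cproj - cproj) *\<^sub>v x = 0\<^sub>v d"
      using \<open>R * cproj - cproj = 0\<^sub>m d d\<close> x by (auto intro!: eq_vecI)
    then have "R *\<^sub>v (cproj *\<^sub>v x) - cproj *\<^sub>v x = 0\<^sub>v d"
      using minus_mult_distrib_mat_vec[OF mult_carrier_mat[OF RC cP] cP x] assoc_mult_mat_vec[OF RC cP x] by simp
    then have 1: "R *\<^sub>v (cproj *\<^sub>v x) = cproj *\<^sub>v x"
      by (rule vec_minus_eq_zeroD[OF mult_mat_vec_carrier[OF RC PxC] PxC])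
    have 2: "R *\<^sub>v (x - cproj *\<^sub>v x) = x - cproj *\<^sub>v x"
      using R cproj_compl[OF x] by blast
    have "R *\<^sub>v x = R *\<^sub>v (cproj *\<^sub>v x + (x - cproj *\<^sub>v x))"
      by (simp only: vec_add_minus_cancel[OF PxC x])
    also have "\<dots> = R *\<^sub>v (cproj *\<^sub>v x) + R *\<^sub>v (x - cproj *\<^sub>v x)"
      by (rule mult_add_distrib_mat_vec[OF RC PxC minus_carrier_vec[OF x PxC]])
    also have "\<dots> = 1\<^sub>m d *\<^sub>v x"
      by (simp only: 1 2 vec_add_minus_cancel[OF PxC x] one_mult_mat_vec[OF x])
    finally show "R *\<^sub>v x = 1\<^sub>m d *\<^sub>v x" .
  qed simp
qed

end

section \<open>Growth of matrix powers\<close>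

text \<open>The part of \<open>growth_coeff\<close> that is constant in \<open>n\<close>: of the
  exponent \<open>n - r + 1\<close> in the denominator, the summand \<open>1 - r\<close> is moved to
  the numerator with opposite sign.\<close>

definition growth_const :: "complex mat \<Rightarrow> real" where
  "growth_const M = fact (max_jordan_size M - 1) * spectral_radius M powi (int (max_jordan_size M) - 1)"

lemma growth_const_pos: "spectral_radius M > 0 \<Longrightarrow> growth_const M > 0"
  by (simp add: growth_const_def)

lemma growth_coeff_eq:
  assumes "spectral_radius M > 0"
  shows "growth_coeff M n =
    growth_const M / (real n ^ (max_jordan_size M - 1) * spectral_radius M ^ n)"
proof -
  have "spectral_radius M powi (int n - int (max_jordan_size M) + 1) =
      spectral_radius M powi (int n - (int (max_jordan_size M) - 1))"
    by (rule arg_cong[where f="\<lambda>i. spectral_radius M powi i"]) simp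
  also have "\<dots> = spectral_radius M ^ n / spectral_radius M powi (int (max_jordan_size M) - 1)"
    using assms by (subst power_int_diff) auto
  finally show ?thesis
    unfolding growth_coeff_def Let_def growth_const_def by simp
qed

lemma growth_coeff_pos: "spectral_radius M > 0 \<Longrightarrow> n > 0 \<Longrightarrow> growth_coeff M n > 0"
  by (simp add: growth_coeff_eq growth_const_pos)

text \<open>Compares normalisation at a level with that at \<open>l\<close> digits fewer. The
  polynomial part of the ratio tends to 1 and the exponential part is exactly
  \<open>1 / \<rho> ^ l\<close>, with \<open>\<rho>\<close> the spectral radius. At
  \<open>n = 0\<close> the polynomial factor may vanish, hence "eventually".\<close>

lemma growth_coeff_shift:
  assumes "spectral_radius M > 0"
  obtains q where "(\<lambda>n. q n) \<longlonglongrightarrow> 1 / spectral_radius M ^ l"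
    and "\<forall>\<^sub>F n in sequentially. growth_coeff M (n + l) = q n * growth_coeff M n"
proof -
  let ?s = "max_jordan_size M - 1" and ?\<rho> = "spectral_radius M"
  have "(\<lambda>n. (real n / real (n + l)) ^ ?s * (1 / ?\<rho> ^ l)) \<longlonglongrightarrow> 1 ^ ?s * (1 / ?\<rho> ^ l)"
    by (intro tendsto_intros) real_asymp
  moreover have "\<forall>\<^sub>F n in sequentially.
      growth_coeff M (n + l) = ((real n / real (n + l)) ^ ?s * (1 / ?\<rho> ^ l)) * growth_coeff M n"
    using eventually_gt_at_top[of 0]
  proof eventually_elim
    case (elim n)
    then show ?case
      using assms by (simp add: growth_coeff_eq power_add power_divide field_simps del: of_nat_add)
  qed
  ultimately show ?thesis using that by simp
qed

text \<open>Passing from \<open>p\<close> to \<open>Suc p\<close> multiplies the quotient by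
  \<open>(n - p) / (n * Suc p)\<close>, which tends to \<open>1 / Suc p\<close>.\<close>

lemma choose_over_power_tendsto: "(\<lambda>n. real (n choose p) / real n ^ p) \<longlonglongrightarrow> 1 / fact p"
proof (induction p)
  case (Suc p)
  have "(\<lambda>n. real (n choose p) / real n ^ p * ((real n - real p) / real n) / real (Suc p))
      \<longlonglongrightarrow> 1 / fact p * 1 / real (Suc p)"
    by (intro tendsto_intros Suc) (real_asymp, simp)
  also have "1 / fact p * 1 / real (Suc p) = 1 / fact (Suc p)" by simp
  finally show ?case
  proof (rule Lim_transform_eventually)
    show "\<forall>\<^sub>F n in sequentially. real (n choose p) / real n ^ p * ((real n - real p) / real n) / real (Suc p)
        = real (n choose Suc p) / real n ^ Suc p"
      using eventually_ge_at_top[of "Suc p"]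
    proof eventually_elim
      case (elim n)
      have "Suc p * (n choose Suc p) = (n - p) * (n choose p)"
        using elim binomial_absorption[of p n] binomial_absorb_comp[of n p] by simp
      then have "real (Suc p) * real (n choose Suc p) = (real n - real p) * real (n choose p)"
        using elim by (metis of_nat_mult of_nat_diff Suc_leD)
      then have "real (n choose Suc p) = (real n - real p) * real (n choose p) / real (Suc p)"
        by (simp add: field_simps)
      then show ?case by (simp add: mult_ac)
    qed
  qed
qed simp

text \<open>With \<open>b = sqrt q\<close>, one factor \<open>b ^ n\<close> keeps the polynomial
  bounded and the other tends to 0.\<close>

lemma poly_times_geometric_tendsto_0:
  fixes q :: real
  assumes "0 \<le> q" "q < 1"
  shows "(\<lambda>n. real n ^ p * q ^ n) \<longlonglongrightarrow> 0"
proof (cases "q = 0")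
  case True
  have "\<forall>\<^sub>F n in sequentially. 0 = real n ^ p * q ^ n"
    \<comment> \<open>The index 0 is excluded because \<open>0 ^ 0 = 1\<close>.\<close>
    using eventually_gt_at_top[of 0] by eventually_elim (simp add: True)
  then show ?thesis by (rule Lim_transform_eventually[OF tendsto_const])
next
  case False
  define b where "b = sqrt q"
  have b: "0 < b" "b < 1" "b * b = q" using assms False by (auto simp: b_def)
  from poly_exp_constant_bound[OF b(1,2), of 1 p] obtain c where c: "\<And>n. b ^ n * real n ^ p \<le> c" by auto
  have lim: "(\<lambda>n. c * b ^ n) \<longlonglongrightarrow> 0"
    using b by (intro tendsto_mult_right_zero LIMSEQ_realpow_zero) auto
  have "norm (real n ^ p * q ^ n) \<le> c * b ^ n" for n
  proof -
    have "real n ^ p * q ^ n = (b ^ n * real n ^ p) * b ^ n"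
      by (simp flip: b(3) add: power_mult_distrib)
    also have "\<dots> \<le> c * b ^ n" using b c by (intro mult_right_mono) auto
    finally show ?thesis using assms by simp
  qed
  then show ?thesis
    by (intro Lim_null_comparison[OF always_eventually lim]) simp
qed

text \<open>On and above the diagonal the entries are, for large \<open>n\<close>,
  \<open>(n choose p) * a ^ (n - p)\<close> with \<open>p = j - i\<close>. If
  \<open>cmod a < \<rho>\<close>, geometric decay beats the polynomial. If
  \<open>a = \<rho>\<close>, the exponentials cancel up to a constant, and the block size forces
  \<open>p \<le> s\<close>, so \<open>(n choose p) / n ^ s\<close> converges, to a nonzero limit
  only for \<open>p = s\<close>.\<close>

lemma jordan_block_power_convergent:
  assumes \<rho>: "\<rho> > 0" and a: "cmod a < \<rho> \<or> a = of_real \<rho> \<and> m \<le> Suc s"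
    and ij: "i < m" "j < m"
  shows "convergent (\<lambda>n. complex_of_real (1 / (real n ^ s * \<rho> ^ n)) * (jordan_block m a ^\<^sub>m n) $$ (i, j))"
proof (cases "i \<le> j")
  case False
  then show ?thesis using ij by (simp add: jordan_block_pow convergent_const)
next
  case True
  define p where "p = j - i"
  have p: "p < m" using ij by (auto simp: p_def)
  have entry: "(jordan_block m a ^\<^sub>m n) $$ (i, j) = of_nat (n choose p) * a ^ (n + i - j)" for n
    using ij True by (simp add: jordan_block_pow p_def)
  \<comment> \<open>The subtraction is truncated, so the power law is available only from
    \<open>n = p\<close> on; this is why the estimates below are eventual.\<close>
  have exp: "n + i - j = n - p" if "n \<ge> p" for n using True that by (auto simp: p_def)
  show ?thesis
  proof (cases "cmod a < \<rho>")
    case less: True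
    define q where "q = cmod a / \<rho>"
    have q: "0 \<le> q" "q < 1" using less \<rho> by (auto simp: q_def)
    have "(\<lambda>n. complex_of_real (1 / (real n ^ s * \<rho> ^ n)) * (of_nat (n choose p) * a ^ (n + i - j))) \<longlonglongrightarrow> 0"
    proof (cases "a = 0")
      case True
      have "\<forall>\<^sub>F n in sequentially. 0 = complex_of_real (1 / (real n ^ s * \<rho> ^ n)) * (of_nat (n choose p) * a ^ (n + i - j))"
        using eventually_gt_at_top[of p] by eventually_elim (simp add: True exp)
      then show ?thesis by (rule Lim_transform_eventually[OF tendsto_const])
    next
      case False
      have "(\<lambda>n. (real n ^ p * q ^ n) / cmod a ^ p) \<longlonglongrightarrow> 0 / cmod a ^ p"
        by (intro tendsto_intros poly_times_geometric_tendsto_0 q) (use False in auto)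
      then have lim: "(\<lambda>n. (real n ^ p * q ^ n) / cmod a ^ p) \<longlonglongrightarrow> 0" by simp
      show ?thesis
      proof (rule Lim_null_comparison[OF _ lim])
        show "\<forall>\<^sub>F n in sequentially. norm (complex_of_real (1 / (real n ^ s * \<rho> ^ n)) * (of_nat (n choose p) * a ^ (n + i - j)))
            \<le> (real n ^ p * q ^ n) / cmod a ^ p"
          using eventually_gt_at_top[of p]
        proof eventually_elim
          case (elim n)
          have "real (n choose p) \<le> real n ^ p"
            using binomial_le_pow[of p n] elim by (metis of_nat_le_iff of_nat_power less_imp_le)
          moreover have "1 \<le> real n ^ s" using elim by simp
          ultimately have "real (n choose p) / real n ^ s \<le> real n ^ p / 1"
            by (intro frac_le) auto
          then have "real (n choose p) / real n ^ s * (cmod a ^ (n - p) / \<rho> ^ n) \<le> real n ^ p * (cmod a ^ (n - p) / \<rho> ^ n)"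
            using \<rho> by (intro mult_right_mono) auto
          moreover have "cmod a ^ (n - p) = cmod a ^ n / cmod a ^ p"
            using elim False by (simp add: power_diff)
          ultimately show ?case
            using \<rho> elim by (simp add: exp norm_mult norm_divide norm_power q_def power_divide mult_ac)
        qed
      qed
    qed
    then show ?thesis by (auto simp: entry convergent_def)
  next
    case False
    with a have a: "a = of_real \<rho>" "m \<le> Suc s" by auto
    have ps: "p \<le> s" using p a by simp
    have "convergent (\<lambda>n. 1 / real n ^ (s - p))"
    proof (cases "s = p")
      case False
      then have "(\<lambda>n. inverse (real n) ^ (s - p)) \<longlonglongrightarrow> 0 ^ (s - p)"
        by (intro tendsto_intros lim_inverse_n)
      then show ?thesis by (auto simp: convergent_def inverse_eq_divide power_divide)
    qed (simp add: convergent_const)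
    then obtain l where l: "(\<lambda>n. 1 / real n ^ (s - p)) \<longlonglongrightarrow> l" by (auto simp: convergent_def)
    have "(\<lambda>n. complex_of_real (real (n choose p) / real n ^ p * (1 / real n ^ (s - p)) * (1 / \<rho> ^ p)))
        \<longlonglongrightarrow> complex_of_real (1 / fact p * l * (1 / \<rho> ^ p))"
      by (intro tendsto_intros choose_over_power_tendsto l)
    then have "(\<lambda>n. complex_of_real (1 / (real n ^ s * \<rho> ^ n)) * (of_nat (n choose p) * a ^ (n + i - j)))
        \<longlonglongrightarrow> complex_of_real (1 / fact p * l * (1 / \<rho> ^ p))"
    proof (rule Lim_transform_eventually)
      show "\<forall>\<^sub>F n in sequentially. complex_of_real (real (n choose p) / real n ^ p * (1 / real n ^ (s - p)) * (1 / \<rho> ^ p))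
         = complex_of_real (1 / (real n ^ s * \<rho> ^ n)) * (of_nat (n choose p) * a ^ (n + i - j))"
        using eventually_gt_at_top[of p]
      proof eventually_elim
        case (elim n)
        have e1: "a ^ (n + i - j) = complex_of_real (\<rho> ^ n / \<rho> ^ p)"
          using elim \<rho> by (simp add: exp a power_diff)
        have e2: "real n ^ s = real n ^ p * real n ^ (s - p)"
          using ps by (simp flip: power_add)
        have "real (n choose p) / real n ^ p * (1 / real n ^ (s - p)) * (1 / \<rho> ^ p) =
            1 / (real n ^ s * \<rho> ^ n) * (real (n choose p) * (\<rho> ^ n / \<rho> ^ p))"
          using \<rho> by (simp add: e2)
        then have "complex_of_real (real (n choose p) / real n ^ p * (1 / real n ^ (s - p)) * (1 / \<rho> ^ p)) =
            complex_of_real (1 / (real n ^ s * \<rho> ^ n) * (real (n choose p) * (\<rho> ^ n / \<rho> ^ p)))"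
          by (rule arg_cong)
        then show ?case unfolding e1 by (simp only: of_real_mult of_real_of_nat_eq)
      qed
    qed
    then show ?thesis by (auto simp: entry convergent_def)
  qed
qed

text \<open>Powers of a block diagonal matrix are taken blockwise, and entries outside the blocks
  stay 0, so convergence has to be known only within single Jordan blocks.\<close>

lemma jordan_matrix_power_convergent:
  fixes c :: "nat \<Rightarrow> complex"
  assumes "\<And>m a i j. (m, a) \<in> set n_as \<Longrightarrow> i < m \<Longrightarrow> j < m \<Longrightarrow>
      convergent (\<lambda>n. c n * (jordan_block m a ^\<^sub>m n) $$ (i, j))"
    and "i < sum_list (map fst n_as)" "j < sum_list (map fst n_as)"
  shows "convergent (\<lambda>n. c n * (jordan_matrix n_as ^\<^sub>m n) $$ (i, j))"
  using assms
proof (induction n_as arbitrary: i j)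
  case (Cons na n_as)
  obtain m a where na: "na = (m, a)" by force
  have pow: "jordan_matrix (na # n_as) ^\<^sub>m n = four_block_mat (jordan_block m a ^\<^sub>m n)
      (0\<^sub>m m (sum_list (map fst n_as))) (0\<^sub>m (sum_list (map fst n_as)) m) (jordan_matrix n_as ^\<^sub>m n)" for n
  proof -
    have d: "dim_row (jordan_matrix n_as ^\<^sub>m n) = sum_list (map fst n_as)"
      "dim_col (jordan_matrix n_as ^\<^sub>m n) = sum_list (map fst n_as)" by auto
    show ?thesis
      using d unfolding na jordan_matrix_pow by (simp add: Let_def)
  qed
  have IH: "convergent (\<lambda>n. c n * (jordan_matrix n_as ^\<^sub>m n) $$ (i, j))"
    if "i < sum_list (map fst n_as)" "j < sum_list (map fst n_as)" for i j
    using Cons.prems(1) that by (intro Cons.IH) auto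
  have B: "convergent (\<lambda>n. c n * (jordan_block m a ^\<^sub>m n) $$ (i, j))" if "i < m" "j < m" for i j
    using that by (intro Cons.prems(1)) (auto simp: na)
  have ij: "i < m + sum_list (map fst n_as)" "j < m + sum_list (map fst n_as)"
    using Cons.prems by (auto simp: na)
  consider "i < m" "j < m" | "i < m \<longleftrightarrow> \<not> j < m" | "\<not> i < m" "\<not> j < m" by auto
  then show ?case
  proof cases
    case 1
    have "dim_col (jordan_block m a ^\<^sub>m n) = m" "dim_row (jordan_block m a ^\<^sub>m n) = m"
      "dim_col (jordan_matrix n_as ^\<^sub>m n) = sum_list (map fst n_as)"
      "dim_row (jordan_matrix n_as ^\<^sub>m n) = sum_list (map fst n_as)" for n by simp_all
    then show ?thesis using B 1 ij by (simp add: pow del: pow_mat_dim)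
  next
    case 2
    then have "(jordan_matrix (na # n_as) ^\<^sub>m n) $$ (i, j) = 0" for n
      using ij by (auto simp: pow)
    then show ?thesis by (simp add: convergent_const)
  next
    case 3
    have "(jordan_matrix (na # n_as) ^\<^sub>m n) $$ (i, j) = (jordan_matrix n_as ^\<^sub>m n) $$ (i - m, j - m)" for n
    proof -
      have "dim_col (jordan_matrix n_as ^\<^sub>m n) = sum_list (map fst n_as)"
        "dim_row (jordan_matrix n_as ^\<^sub>m n) = sum_list (map fst n_as)" by simp_all
      then show ?thesis
        unfolding pow using 3 ij by (subst index_mat_four_block(1)) (simp_all only: jordan_block_pow_dim if_False)
    qed
    then show ?thesis using IH[of "i - m" "j - m"] 3 ij by simp
  qed
qed simp

lemma convergent_sum_fun:
  fixes f :: "'i \<Rightarrow> nat \<Rightarrow> 'a :: real_normed_vector"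
  assumes "\<And>i. i \<in> I \<Longrightarrow> convergent (f i)"
  shows "convergent (\<lambda>n. \<Sum>i\<in>I. f i n)"
proof -
  have "(\<lambda>n. \<Sum>i\<in>I. f i n) \<longlonglongrightarrow> (\<Sum>i\<in>I. lim (f i))"
    using assms by (intro tendsto_sum) (simp add: convergent_LIMSEQ_iff)
  then show ?thesis by (auto simp: convergent_def)
qed

text \<open>No Jordan block exceeds the size of the matrix. So the set in
  \<open>max_jordan_size\<close> is finite, without which its \<open>Max\<close> would say
  nothing.\<close>

lemma le_max_jordan_size:
  assumes M: "M \<in> carrier_mat d d" and "jordan_nf M n_as" "(m, z) \<in> set n_as" "cmod z = spectral_radius M"
  shows "m \<le> max_jordan_size M"
  unfolding max_jordan_size_def
proof (rule Max_ge)
  have "m \<le> d" if "jordan_nf M n_as" "(m, z) \<in> set n_as" for m z n_as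
  proof -
    from that(1) obtain P Q where "similar_mat_wit M (jordan_matrix n_as) P Q"
      unfolding jordan_nf_def similar_mat_def by auto
    from similar_mat_witD2(5)[OF M this] have "d = sum_list (map fst n_as)" 
      by (metis carrier_matD(1) jordan_matrix_dim(1))
    moreover have "m \<in> set (map fst n_as)" using that(2) by force
    ultimately show ?thesis by (simp add: member_le_sum_list)
  qed
  then have "{m. \<exists>n_as z. jordan_nf M n_as \<and> (m, z) \<in> set n_as \<and> cmod z = spectral_radius M} \<subseteq> {..d}" by auto
  then show "finite {m. \<exists>n_as z. jordan_nf M n_as \<and> (m, z) \<in> set n_as \<and> cmod z = spectral_radius M}"
    by (rule finite_subset) simp
qed (use assms in auto)

text \<open>In Jordan form the entries are fixed linear combinations of entries of block powers. By
  \<open>per\<close>, an eigenvalue either has smaller modulus or equals the spectral radius, in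
  which case its blocks are bounded by \<open>max_jordan_size\<close>: the two cases of
  \<open>jordan_block_power_convergent\<close>. Any other phase could make entries
  oscillate.\<close>

lemma power_entry_convergent:
  assumes M: "M \<in> carrier_mat d d" and \<rho>: "spectral_radius M > 0"
    and per: "peripheral M = {complex_of_real (spectral_radius M)}"
    and ij: "i < d" "j < d"
  shows "convergent (\<lambda>n. complex_of_real (growth_coeff M n) * (M ^\<^sub>m n) $$ (i, j))"
proof -
  let ?\<rho> = "spectral_radius M" and ?s = "max_jordan_size M - 1"
  define c where "c n = complex_of_real (1 / (real n ^ ?s * ?\<rho> ^ n))" for n
  obtain as where "char_poly M = (\<Prod>a\<leftarrow>as. [:- a, 1:])" using char_poly_factorized[OF M] by auto
  then obtain n_as where jnf: "jordan_nf M n_as" using jordan_nf_exists[OF M] by auto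
  then obtain S T where wit: "similar_mat_wit M (jordan_matrix n_as) S T"
    unfolding jordan_nf_def similar_mat_def by auto
  define J where "J = jordan_matrix n_as"
  note w = similar_mat_witD2[OF M wit, folded J_def]
  have d: "d = sum_list (map fst n_as)" using carrier_matD(1)[OF w(5)] by (simp add: J_def)
  have J: "convergent (\<lambda>n. c n * (J ^\<^sub>m n) $$ (i, j))" if "i < d" "j < d" for i j
    unfolding J_def c_def
  proof (rule jordan_matrix_power_convergent)
    fix m a i j assume ma: "(m, a) \<in> set n_as" "i < m" "j < m"
    have ev: "eigenvalue M a"
      unfolding eigenvalue_root_char_poly[OF M] jordan_nf_char_poly[OF jnf] poly_prod_list
      using ma by (auto simp: prod_list_zero_iff intro!: image_eqI[of _ _ "(m, a)"])
    then have "cmod a \<in> norm ` spectrum M" by (auto simp: spectrum_def)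
    \<comment> \<open>The indices in \<open>ij\<close> supply \<open>d > 0\<close>, which makes the
      spectral radius a genuine maximum.\<close>
    then have le: "cmod a \<le> ?\<rho>" using spectral_radius_mem_max(2)[OF M] ij by auto
    have "a = of_real ?\<rho> \<and> m \<le> Suc ?s" if "cmod a = ?\<rho>"
    proof -
      have "a \<in> peripheral M" using ev that by (simp add: peripheral_def)
      then show ?thesis using per le_max_jordan_size[OF M jnf ma(1) that] by simp
    qed
    then show "convergent (\<lambda>n. complex_of_real (1 / (real n ^ ?s * ?\<rho> ^ n)) * (jordan_block m a ^\<^sub>m n) $$ (i, j))"
      using le by (intro jordan_block_power_convergent[OF \<rho> _ ma(2,3)]) linarith
  qed (use that d in auto)
  have entry: "(M ^\<^sub>m n) $$ (i, j) = (\<Sum>b<d. \<Sum>a<d. S $$ (i, a) * (J ^\<^sub>m n) $$ (a, b) * T $$ (b, j))" for n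
  proof -
    have "M ^\<^sub>m n = S * J ^\<^sub>m n * T" using similar_mat_wit_pow_id[OF wit] by (simp add: J_def)
    moreover have "J ^\<^sub>m n \<in> carrier_mat d d" using w by simp
    moreover from this have "dim_row (J ^\<^sub>m n) = d" "dim_col (J ^\<^sub>m n) = d" by auto
    ultimately show ?thesis using w(6,7) ij
      by (simp add: scalar_prod_def sum_distrib_right lessThan_atLeast0 del: assoc_mult_mat pow_mat_dim pow_mat_dim_square)
  qed
  have "convergent (\<lambda>n. \<Sum>b<d. \<Sum>a<d. S $$ (i, a) * T $$ (b, j) * (c n * (J ^\<^sub>m n) $$ (a, b)))"
    by (intro convergent_sum_fun convergent_mult convergent_const J) auto
  also have "(\<lambda>n. \<Sum>b<d. \<Sum>a<d. S $$ (i, a) * T $$ (b, j) * (c n * (J ^\<^sub>m n) $$ (a, b))) =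
      (\<lambda>n. c n * (M ^\<^sub>m n) $$ (i, j))"
    unfolding entry by (simp add: sum_distrib_left mult_ac)
  finally have "convergent (\<lambda>n. complex_of_real (growth_const M) * (c n * (M ^\<^sub>m n) $$ (i, j)))"
    by (rule convergent_mult[OF convergent_const])
  then show ?thesis
    by (simp add: c_def growth_coeff_eq[OF \<rho>] mult_ac)
qed

section \<open>The space of the representation\<close>

text \<open>The third part is the induction principle of the span: what holds on the generators and
  defines a subspace holds on all of it.\<close>

lemma rep_space_vec_subspace:
  assumes gen: "\<And>n. transpose_mat (digit_mat d k A n) *\<^sub>v u \<in> carrier_vec d"
  shows "vec_subspace d (rep_space d k u A)"
    and "n \<ge> 1 \<Longrightarrow> transpose_mat (digit_mat d k A n) *\<^sub>v u \<in> rep_space d k u A"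
    and "\<lbrakk>vec_subspace d N; \<And>n. n \<ge> 1 \<Longrightarrow> transpose_mat (digit_mat d k A n) *\<^sub>v u \<in> N\<rbrakk> \<Longrightarrow> rep_space d k u A \<subseteq> N"
proof -
  interpret vs: vec_space "TYPE(real)" d .
  let ?G = "{transpose_mat (digit_mat d k A n) *\<^sub>v u | n. n \<ge> 1}"
  have G: "?G \<subseteq> carrier_vec d" using gen by auto
  have sp: "rep_space d k u A = vs.span ?G" by (simp add: rep_space_def)
  show "vec_subspace d (rep_space d k u A)"
    unfolding sp
  proof
    show "vs.span ?G \<subseteq> carrier_vec d" using vs.span_closed[of ?G] G by auto
    show "0\<^sub>v d \<in> vs.span ?G" using vs.span_zero[of ?G] by simp
    show "x + y \<in> vs.span ?G" if "x \<in> vs.span ?G" "y \<in> vs.span ?G" for x y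
      using vs.span_add1[of ?G x y] G that by simp
    show "c \<cdot>\<^sub>v x \<in> vs.span ?G" if "x \<in> vs.span ?G" for c x
      by (rule vs.smult_in_span[OF G that])
  qed
  show "transpose_mat (digit_mat d k A n) *\<^sub>v u \<in> rep_space d k u A" if "n \<ge> 1"
    unfolding sp using vs.in_own_span[of ?G] G that by auto
  show "rep_space d k u A \<subseteq> N"
    if N: "vec_subspace d N" "\<And>n. n \<ge> 1 \<Longrightarrow> transpose_mat (digit_mat d k A n) *\<^sub>v u \<in> N"
    unfolding sp
  proof (rule vs.span_is_subset)
    interpret N: vec_subspace d N by (rule N(1))
    show "?G \<subseteq> N" using N(2) by auto
    show "submodule class_ring N vs.V"
      using N.subset N.zero N.add N.smult
      by unfold_locales auto
  qed
qed

text \<open>Splits integers into a prefix \<open>q\<close> and a tail \<open>r\<close>. It is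
  applied with \<open>K\<close> equal to \<open>k\<close>, for the last digit, and to powers of
  \<open>k\<close>, for blocks of digits.\<close>

lemma sum_regroup:
  fixes g :: "nat \<Rightarrow> 'b :: comm_monoid_add"
  assumes "a \<le> b"
  shows "sum g {a * K..<b * K} = (\<Sum>q\<in>{a..<b}. \<Sum>r<K. g (q * K + r))"
  using assms
proof (induction b rule: dec_induct)
  case (step b)
  have "sum g {a * K..<Suc b * K} = sum g {a * K..<b * K} + sum g {b * K..<b * K + K}"
    using step by (subst sum.atLeastLessThan_concat) (auto simp: add_mult_distrib add.commute)
  also have "sum g {b * K..<b * K + K} = (\<Sum>r<K. g (b * K + r))"
    using sum.shift_bounds_nat_ivl[of g 0 "b * K" K] by (simp add: lessThan_atLeast0 add.commute)
  finally show ?case using step by simp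
qed simp

lemma pow_mat_Suc_left:
  fixes M :: "'a :: semiring_1 mat"
  assumes M: "M \<in> carrier_mat n n"
  shows "M ^\<^sub>m Suc m = M * M ^\<^sub>m m"
proof (induction m)
  case (Suc m)
  have "M ^\<^sub>m Suc (Suc m) = M * M ^\<^sub>m m * M" using Suc by simp
  also have "\<dots> = M * (M ^\<^sub>m m * M)" by (rule assoc_mult_mat[OF M pow_carrier_mat[OF M] M])
  finally show ?case by simp
qed (use M in simp)

text \<open>The right vector is left out: \<open>V\<close>, the total matrix and its projected
  version depend only on \<open>u\<close> and \<open>A\<close>.\<close>

locale representation =
  fixes k d :: nat and u :: "real Matrix.vec" and A :: "nat \<Rightarrow> real mat"
  assumes k: "k \<ge> 2" and u: "u \<in> carrier_vec d" and A: "\<And>j. j < k \<Longrightarrow> A j \<in> carrier_mat d d"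
begin

abbreviation "D \<equiv> digit_mat d k A"
abbreviation "T \<equiv> total_mat d k A"
abbreviation "W \<equiv> rep_space d k u A"

definition row_vec :: "nat \<Rightarrow> real Matrix.vec" where
  "row_vec n = transpose_mat (D n) *\<^sub>v u"

lemma D_carrier: "D n \<in> carrier_mat d d"
proof (induction n rule: less_induct)
  case (less n)
  show ?case
  proof (cases "n = 0")
    case False
    then have "D (n div k) \<in> carrier_mat d d" using k by (intro less) auto
    moreover have "A (n mod k) \<in> carrier_mat d d" using k by (intro A) auto
    ultimately show ?thesis using k False by (subst digit_mat.simps) auto
  qed (use k in \<open>simp add: digit_mat.simps\<close>)
qed

lemma T_carrier: "T \<in> carrier_mat d d"
  by (simp add: total_mat_def)

lemma row_vec_carrier: "row_vec n \<in> carrier_vec d"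
  unfolding row_vec_def using D_carrier[of n] u by (intro mult_mat_vec_carrier[of _ d d]) auto

sublocale W: vec_subspace d W
  using rep_space_vec_subspace(1)[of d k A u] row_vec_carrier by (simp add: row_vec_def)

lemma row_vec_in: "n \<ge> 1 \<Longrightarrow> row_vec n \<in> W"
  using rep_space_vec_subspace(2)[of d k A u] row_vec_carrier by (simp add: row_vec_def)

text \<open>A new last digit multiplies the digit product on the right, hence acts by its transpose
  on the left. For \<open>n = 0\<close> and \<open>j = 0\<close> this fails in general, because a
  leading zero contributes no matrix.\<close>

lemma row_vec_append_digit:
  assumes "n \<ge> 1" "j < k"
  shows "row_vec (n * k + j) = transpose_mat (A j) *\<^sub>v row_vec n"
proof -
  have "D (n * k + j) = D n * A j"
    using assms k by (subst digit_mat.simps) auto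
  then have "row_vec (n * k + j) = (transpose_mat (A j) * transpose_mat (D n)) *\<^sub>v u"
    unfolding row_vec_def by (simp only: transpose_mult[OF D_carrier A[OF assms(2)]])
  also have "\<dots> = transpose_mat (A j) *\<^sub>v row_vec n"
    unfolding row_vec_def
    by (rule assoc_mult_mat_vec[OF _ _ u]) (use D_carrier A[OF assms(2)] in auto)
  finally show ?thesis .
qed

lemma row_vec_digit: "1 \<le> j \<Longrightarrow> j < k \<Longrightarrow> row_vec j = transpose_mat (A j) *\<^sub>v u"
  using k A[of j] by (simp add: row_vec_def digit_mat.simps)

text \<open>The vectors of \<open>W\<close> that stay in \<open>W\<close> form a subspace
  \<open>?N\<close>, and appending the digit \<open>j\<close> turns the generator for
  \<open>n\<close> into the generator for \<open>n * k + j\<close>, which is again positive.\<close>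

lemma W_closed_transpose:
  assumes "j < k" "w \<in> W"
  shows "transpose_mat (A j) *\<^sub>v w \<in> W"
proof -
  let ?N = "{w \<in> W. transpose_mat (A j) *\<^sub>v w \<in> W}"
  have At: "transpose_mat (A j) \<in> carrier_mat d d" using A[OF assms(1)] by simp
  have "vec_subspace d ?N"
  proof
    show "?N \<subseteq> carrier_vec d" using W.subset by auto
    have "transpose_mat (A j) *\<^sub>v 0\<^sub>v d = 0\<^sub>v d" using At by auto
    then show "0\<^sub>v d \<in> ?N" using W.zero by simp
    show "x + y \<in> ?N" if "x \<in> ?N" "y \<in> ?N" for x y
      using that W.add W.carrier by (auto simp: mult_add_distrib_mat_vec[OF At])
    show "c \<cdot>\<^sub>v x \<in> ?N" if "x \<in> ?N" for c x
      using that W.smult W.carrier by (auto simp: mult_mat_vec[OF At])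
  qed
  moreover have "row_vec n \<in> ?N" if "n \<ge> 1" for n
  proof -
    have "n * k + j \<ge> 1" using that k by (simp add: Suc_le_eq)
    then show ?thesis
      using row_vec_append_digit[OF that assms(1)] row_vec_in[OF that] row_vec_in[of "n * k + j"] by simp
  qed
  ultimately have "W \<subseteq> ?N"
    using rep_space_vec_subspace(3)[of d k A u ?N] row_vec_carrier by (simp add: row_vec_def)
  then show ?thesis using assms(2) by auto
qed

lemma scalar_prod_T:
  assumes w: "w \<in> carrier_vec d" and x: "x \<in> carrier_vec d"
  shows "scalar_prod w (T *\<^sub>v x) = (\<Sum>j<k. scalar_prod (transpose_mat (A j) *\<^sub>v w) x)"
proof -
  have "scalar_prod w (T *\<^sub>v x) = (\<Sum>i<d. \<Sum>l<d. \<Sum>j<k. w $ i * (A j $$ (i, l) * x $ l))"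
    using w x by (simp add: scalar_prod_def total_mat_def lessThan_atLeast0 sum_distrib_left sum_distrib_right)
  also have "\<dots> = (\<Sum>i<d. \<Sum>j<k. \<Sum>l<d. w $ i * (A j $$ (i, l) * x $ l))"
    by (intro sum.cong refl sum.swap)
  also have "\<dots> = (\<Sum>j<k. \<Sum>i<d. \<Sum>l<d. w $ i * (A j $$ (i, l) * x $ l))"
    by (rule sum.swap)
  also have "\<dots> = (\<Sum>j<k. scalar_prod w (A j *\<^sub>v x))"
  proof (rule sum.cong[OF refl])
    fix j assume "j \<in> {..<k}"
    then have Aj: "A j \<in> carrier_mat d d" using A by simp
    then have "(A j *\<^sub>v x) $ i = (\<Sum>l<d. A j $$ (i, l) * x $ l)" if "i < d" for i
      using x that by (simp add: scalar_prod_def lessThan_atLeast0)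
    then show "(\<Sum>i<d. \<Sum>l<d. w $ i * (A j $$ (i, l) * x $ l)) = scalar_prod w (A j *\<^sub>v x)"
      using Aj by (simp add: scalar_prod_def[of w] lessThan_atLeast0 sum_distrib_left del: index_mult_mat_vec)
  qed
  also have "\<dots> = (\<Sum>j<k. scalar_prod (transpose_mat (A j) *\<^sub>v w) x)"
    using A w x by (intro sum.cong refl transpose_vec_mult_scalar[symmetric]) auto
  finally show ?thesis .
qed

text \<open>The summation runs over all numbers whose expansion is that of \<open>q\<close> followed
  by \<open>n\<close> free digits. The free last digit sums the matrices \<open>A j\<close> to
  \<open>T\<close>, which is absorbed into \<open>x\<close>; hence the induction generalises
  \<open>x\<close>.\<close>

lemma sum_row_vec:
  assumes q: "q \<ge> 1" and x: "x \<in> carrier_vec d"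
  shows "(\<Sum>r<k ^ n. scalar_prod (row_vec (q * k ^ n + r)) x) = scalar_prod (row_vec q) (T ^\<^sub>m n *\<^sub>v x)"
  using x
proof (induction n arbitrary: x)
  case 0
  then show ?case using T_carrier by simp
next
  case (Suc n)
  have "(\<Sum>r<k ^ Suc n. scalar_prod (row_vec (q * k ^ Suc n + r)) x) =
      (\<Sum>s<k ^ n. \<Sum>j<k. scalar_prod (row_vec (q * k ^ Suc n + (s * k + j))) x)"
    using sum_regroup[of 0 "k ^ n" "\<lambda>r. scalar_prod (row_vec (q * k ^ Suc n + r)) x" k]
    by (simp add: lessThan_atLeast0 mult.commute)
  also have "\<dots> = (\<Sum>s<k ^ n. scalar_prod (row_vec (q * k ^ n + s)) (T *\<^sub>v x))"
  proof (rule sum.cong[OF refl])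
    fix s
    have "q * k ^ n + s \<ge> 1" using q k by (simp add: Suc_le_eq)
    moreover have "q * k ^ Suc n + (s * k + j) = (q * k ^ n + s) * k + j" for j by (simp add: algebra_simps)
    ultimately have "row_vec (q * k ^ Suc n + (s * k + j)) = transpose_mat (A j) *\<^sub>v row_vec (q * k ^ n + s)"
      if "j < k" for j
      using row_vec_append_digit[of "q * k ^ n + s" j] that by (simp only:)
    then show "(\<Sum>j<k. scalar_prod (row_vec (q * k ^ Suc n + (s * k + j))) x) =
        scalar_prod (row_vec (q * k ^ n + s)) (T *\<^sub>v x)"
      unfolding scalar_prod_T[OF row_vec_carrier Suc.prems]
      by (intro sum.cong refl) (simp only: lessThan_iff)
  qed
  also have "\<dots> = scalar_prod (row_vec q) (T ^\<^sub>m n *\<^sub>v (T *\<^sub>v x))"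
    using Suc.prems T_carrier by (intro Suc.IH) auto
  also have "T ^\<^sub>m n *\<^sub>v (T *\<^sub>v x) = T ^\<^sub>m Suc n *\<^sub>v x"
    using assoc_mult_mat_vec[of "T ^\<^sub>m n" d d T d x] T_carrier Suc.prems by simp
  finally show ?case .
qed

text \<open>The real matrix underlying \<open>tilde_mat\<close>; digit sums of \<open>f\<close> are
  computed with it before passing to complex entries.\<close>

definition B :: "real mat" where
  "B = orth_proj d W * T * orth_proj d W"

lemma B_carrier: "B \<in> carrier_mat d d"
  using W.orth_proj_carrier T_carrier by (simp add: B_def)

lemma tilde_mat_eq: "tilde_mat d k u A = map_mat complex_of_real B"
  by (simp add: tilde_mat_def B_def Let_def)

text \<open>One factor \<open>T\<close> moves to the left as transposed digit matrices, which
  replace \<open>w\<close> by other vectors of \<open>W\<close>; the induction therefore generalises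
  \<open>w\<close>. Those vectors permit the inner projection and \<open>w\<close> itself the outer
  one, which turns \<open>T\<close> into \<open>B\<close>.\<close>

lemma scalar_prod_T_power:
  assumes w: "w \<in> W" and x: "x \<in> carrier_vec d"
  shows "scalar_prod w (T ^\<^sub>m n *\<^sub>v x) = scalar_prod w (B ^\<^sub>m n *\<^sub>v x)"
  using w
proof (induction n arbitrary: w)
  case 0
  then show ?case using T_carrier B_carrier by simp
next
  case (Suc n)
  let ?P = "orth_proj d W"
  note PC = W.orth_proj_carrier
  have Tn: "T ^\<^sub>m n *\<^sub>v x \<in> carrier_vec d" and Bn: "B ^\<^sub>m n *\<^sub>v x \<in> carrier_vec d"
    using T_carrier B_carrier x by (auto intro!: mult_mat_vec_carrier pow_carrier_mat)
  have pow: "M ^\<^sub>m Suc n *\<^sub>v x = M *\<^sub>v (M ^\<^sub>m n *\<^sub>v x)" if M: "M \<in> carrier_mat d d" for M :: "real mat"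
    unfolding pow_mat_Suc_left[OF M] by (rule assoc_mult_mat_vec[OF M pow_carrier_mat[OF M] x])
  define y where "y = B ^\<^sub>m n *\<^sub>v x"
  have y: "y \<in> carrier_vec d" using Bn by (simp add: y_def)
  have Py: "?P *\<^sub>v y \<in> carrier_vec d" by (rule W.orth_proj_vec_carrier)
  have "scalar_prod w (T ^\<^sub>m Suc n *\<^sub>v x) = (\<Sum>j<k. scalar_prod (transpose_mat (A j) *\<^sub>v w) (T ^\<^sub>m n *\<^sub>v x))"
    unfolding pow[OF T_carrier] by (rule scalar_prod_T[OF W.carrier[OF Suc.prems] Tn])
  also have "\<dots> = (\<Sum>j<k. scalar_prod (transpose_mat (A j) *\<^sub>v w) y)"
    unfolding y_def by (intro sum.cong refl Suc.IH W_closed_transpose Suc.prems) simp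
  also have "\<dots> = (\<Sum>j<k. scalar_prod (transpose_mat (A j) *\<^sub>v w) (?P *\<^sub>v y))"
    by (intro sum.cong refl W.scalar_prod_orth_proj[symmetric] W_closed_transpose Suc.prems y) simp
  also have "\<dots> = scalar_prod w (T *\<^sub>v (?P *\<^sub>v y))"
    by (rule scalar_prod_T[OF W.carrier[OF Suc.prems] Py, symmetric])
  also have "\<dots> = scalar_prod w (?P *\<^sub>v (T *\<^sub>v (?P *\<^sub>v y)))"
    by (rule W.scalar_prod_orth_proj[OF Suc.prems mult_mat_vec_carrier[OF T_carrier Py], symmetric])
  also have "?P *\<^sub>v (T *\<^sub>v (?P *\<^sub>v y)) = (?P * T) *\<^sub>v (?P *\<^sub>v y)"
    by (rule assoc_mult_mat_vec[OF PC T_carrier Py, symmetric])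
  also have "\<dots> = B *\<^sub>v y"
    unfolding B_def by (rule assoc_mult_mat_vec[OF mult_carrier_mat[OF PC T_carrier] PC y, symmetric])
  also have "\<dots> = B ^\<^sub>m Suc n *\<^sub>v x" unfolding y_def by (rule pow[OF B_carrier, symmetric])
  finally show ?case .
qed

end

section \<open>Convergence of the block measures\<close>

text \<open>The Cauchy property passes through the three-term estimate via \<open>Q\<close>. Three
  quarters of \<open>e\<close> are spent, the last one absorbing the non-strict bounds. The
  approximant may change with \<open>e\<close>.\<close>

lemma real_convergent_if_approximable:
  fixes I :: "nat \<Rightarrow> real"
  assumes "\<And>e. e > 0 \<Longrightarrow> \<exists>Q. convergent Q \<and> (\<forall>\<^sub>F n in sequentially. \<bar>I n - Q n\<bar> \<le> e)"
  shows "convergent I"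
proof -
  have "Cauchy I"
  proof (rule metric_CauchyI)
    fix e :: real assume "e > 0"
    then obtain Q where Q: "convergent Q" "\<forall>\<^sub>F n in sequentially. \<bar>I n - Q n\<bar> \<le> e / 4"
      using assms[of "e / 4"] by auto
    from Q(1) have "Cauchy Q" by (rule convergent_Cauchy)
    then obtain N1 where N1: "\<And>m n. m \<ge> N1 \<Longrightarrow> n \<ge> N1 \<Longrightarrow> dist (Q m) (Q n) < e / 4"
      using \<open>e > 0\<close> metric_CauchyD[of Q "e / 4"] by auto
    from Q(2) obtain N2 where N2: "\<And>n. n \<ge> N2 \<Longrightarrow> \<bar>I n - Q n\<bar> \<le> e / 4"
      by (auto simp: eventually_sequentially)
    show "\<exists>M. \<forall>m\<ge>M. \<forall>n\<ge>M. dist (I m) (I n) < e"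
    proof (intro exI[of _ "max N1 N2"] allI impI)
      fix m n assume "m \<ge> max N1 N2" "n \<ge> max N1 N2"
      then have "\<bar>Q m - Q n\<bar> < e / 4" "\<bar>I m - Q m\<bar> \<le> e / 4" "\<bar>I n - Q n\<bar> \<le> e / 4"
        using N1[of m n] N2[of m] N2[of n] by (auto simp: dist_real_def)
      then show "dist (I m) (I n) < e"
        using \<open>e > 0\<close> unfolding dist_real_def by arith
    qed
  qed
  then show ?thesis by (simp add: real_Cauchy_convergent)
qed

text \<open>Here \<open>m\<close> is the integer itself, from the block starting at
  \<open>k ^ N\<close>, while \<open>block_measure\<close> indexes the same atom by its
  offset.\<close>

definition block_point :: "nat \<Rightarrow> nat \<Rightarrow> nat \<Rightarrow> real" where
  "block_point k N m = real (m - k ^ N) / real (k ^ N * (k - 1))"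

lemma block_point_in:
  assumes "k \<ge> 2" "m \<in> {k ^ N..<k ^ (N + 1)}"
  shows "block_point k N m \<in> {0..<1}"
proof -
  have "m - k ^ N < k ^ N * (k - 1)"
    using assms by (simp add: diff_mult_distrib2 mult.commute diff_less_mono)
  then have "real (m - k ^ N) < real (k ^ N * (k - 1))" by (simp only: of_nat_less_iff)
  then show ?thesis using assms(1) by (simp add: block_point_def divide_less_eq)
qed

text \<open>The atoms with prefix \<open>q\<close> fill a cell with left endpoint
  \<open>block_point k l q\<close> and length \<open>1 / (k ^ l * (k - 1))\<close>: the offset from
  \<open>k ^ N\<close> is \<open>(q - k ^ l) * K + r\<close> with \<open>r < K\<close>.\<close>

lemma block_point_prefix:
  assumes k: "k \<ge> 2" and l: "l \<le> N" and q: "q \<ge> k ^ l" and r: "r < k ^ (N - l)"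
  shows "\<bar>block_point k N (q * k ^ (N - l) + r) - block_point k l q\<bar> \<le> 1 / real (k ^ l)"
proof -
  define K where "K = k ^ (N - l)"
  have kN: "k ^ N = k ^ l * K" using l by (simp add: K_def flip: power_add)
  have K: "K > 0" using k by (simp add: K_def)
  have L: "real (k ^ l) > 0" and k1: "real (k - 1) \<ge> 1" using k by auto
  have "k ^ l * K \<le> q * K" using q by simp
  then have "q * K + r - k ^ N = (q - k ^ l) * K + r" by (simp add: kN diff_mult_distrib)
  then have "block_point k N (q * K + r) = (real (q - k ^ l) * real K + real r) / (real (k ^ l) * real K * real (k - 1))"
    by (simp add: block_point_def kN)
  also have "\<dots> = block_point k l q + real r / real K / (real (k ^ l) * real (k - 1))"
  proof -
    have "(a * b + c) / (x * b * y) = a / (x * y) + c / b / (x * y)" if "b > 0" for a b c x y :: real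
      using that by (simp add: add_divide_distrib)
    then show ?thesis using K by (simp add: block_point_def)
  qed
  finally have "block_point k N (q * K + r) - block_point k l q = real r / real K / (real (k ^ l) * real (k - 1))" by simp
  moreover have "real r / real K / (real (k ^ l) * real (k - 1)) \<le> 1 / (real (k ^ l) * 1)"
    using r K L k1 by (intro frac_le mult_left_mono) (auto simp: K_def[symmetric] divide_le_eq)
  ultimately show ?thesis using K L k1 by (simp add: K_def)
qed

lemma block_sum_nonneg: "\<forall>n. f n \<ge> 0 \<Longrightarrow> block_sum k f N \<ge> 0"
  by (simp add: block_sum_def sum_nonneg)

lemma sum_shift_block:
  fixes g :: "nat \<Rightarrow> real"
  assumes "k \<ge> 2"
  shows "(\<Sum>m\<in>{0..<k ^ (N + 1) - k ^ N}. g (k ^ N + m)) = (\<Sum>m\<in>{k ^ N..<k ^ (N + 1)}. g m)"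
proof -
  have "k ^ N \<le> k ^ (N + 1)" using assms by simp
  then show ?thesis
    using sum.shift_bounds_nat_ivl[of g 0 "k ^ N" "k ^ (N + 1) - k ^ N"] by (simp add: add.commute)
qed

lemma block_measure_measurable:
  assumes "k \<ge> 2"
  shows "(\<lambda>m. real m / real (k ^ N * (k - 1))) \<in>
    measurable (point_measure {0..<k ^ (N + 1) - k ^ N} p) torus"
proof -
  have "real m / real (k ^ N * (k - 1)) \<in> {0..<1}" if "m < k ^ (N + 1) - k ^ N" for m
    using block_point_in[OF assms, of "k ^ N + m" N] that by (simp add: block_point_def)
  then show ?thesis by (auto simp: measurable_point_measure_eq1)
qed

lemma block_measure_torus_probs:
  assumes k: "k \<ge> 2" and f: "\<forall>n. f n \<ge> 0" and bs: "block_sum k f N \<noteq> 0"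
  shows "block_measure k f N \<in> torus_probs"
proof -
  have pos: "block_sum k f N > 0" using bs block_sum_nonneg[OF f, of k N] by simp
  have "(\<Sum>m\<in>{0..<k ^ (N + 1) - k ^ N}. ennreal (f (k ^ N + m) / block_sum k f N)) =
      ennreal (\<Sum>m\<in>{0..<k ^ (N + 1) - k ^ N}. f (k ^ N + m) / block_sum k f N)"
    using f pos by (intro sum_ennreal) auto
  also have "\<dots> = ennreal (block_sum k f N / block_sum k f N)"
    using sum_shift_block[OF k, of f N] by (simp add: block_sum_def flip: sum_divide_distrib)
  finally have "prob_space (point_measure {0..<k ^ (N + 1) - k ^ N} (\<lambda>m. ennreal (f (k ^ N + m) / block_sum k f N)))"
    using bs by (intro prob_space_point_measure) auto
  then show ?thesis
    unfolding torus_probs_def block_measure_def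
    using prob_space.prob_space_distr[OF _ block_measure_measurable[OF k]] by simp
qed

lemma integral_block_measure:
  assumes k: "k \<ge> 2" and f: "\<forall>n. f n \<ge> 0" and \<phi>: "torus_continuous \<phi>"
  shows "integral\<^sup>L (block_measure k f N) \<phi> =
    (\<Sum>m\<in>{k ^ N..<k ^ (N + 1)}. f m / block_sum k f N * \<phi> (block_point k N m))"
proof -
  let ?g = "\<lambda>m. f m / block_sum k f N * \<phi> (block_point k N m)"
  have "integral\<^sup>L (block_measure k f N) \<phi> =
      (\<Sum>m\<in>{0..<k ^ (N + 1) - k ^ N}. f (k ^ N + m) / block_sum k f N * \<phi> (real m / real (k ^ N * (k - 1))))"
    unfolding block_measure_def
    using f block_sum_nonneg[OF f, of k N]
    by (subst integral_distr[OF block_measure_measurable[OF k] torus_continuous_borel_measurable(2)[OF \<phi>]])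
      (subst lebesgue_integral_point_measure_finite, auto)
  also have "\<dots> = (\<Sum>m\<in>{0..<k ^ (N + 1) - k ^ N}. ?g (k ^ N + m))"
    by (simp add: block_point_def)
  also have "\<dots> = (\<Sum>m\<in>{k ^ N..<k ^ (N + 1)}. ?g m)"
    by (rule sum_shift_block[OF k])
  finally show ?thesis .
qed

text \<open>Replacing \<open>\<phi>\<close> on each cell of level \<open>l\<close> by its value at
  the left endpoint gives a finite combination of relative cell masses, which converges by
  \<open>cells\<close>; uniform continuity makes the error small uniformly in
  \<open>N\<close>.\<close>

lemma integral_block_measure_convergent:
  assumes k: "k \<ge> 2" and f: "\<forall>n. f n \<ge> 0"
    and bs: "\<forall>\<^sub>F N in sequentially. block_sum k f N \<noteq> 0"
    and cells: "\<And>l q. q \<ge> 1 \<Longrightarrow>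
      convergent (\<lambda>N. (\<Sum>r<k ^ (N - l). f (q * k ^ (N - l) + r)) / block_sum k f N)"
    and \<phi>: "torus_continuous \<phi>"
  shows "convergent (\<lambda>N. integral\<^sup>L (block_measure k f N) \<phi>)"
proof (rule real_convergent_if_approximable)
  fix e :: real assume e: "e > 0"
  have "uniformly_continuous_on {0..1} (\<lambda>x. \<phi> (frac x))"
    using \<phi> unfolding torus_continuous_def
    by (intro compact_uniformly_continuous) (auto intro: continuous_on_subset)
  then obtain \<delta> where \<delta>: "\<delta> > 0"
    "\<And>x y. x \<in> {0..1} \<Longrightarrow> y \<in> {0..1} \<Longrightarrow> dist y x < \<delta> \<Longrightarrow> dist (\<phi> (frac y)) (\<phi> (frac x)) < e"
    using e unfolding uniformly_continuous_on_def by meson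
  have uc: "\<bar>\<phi> y - \<phi> x\<bar> \<le> e" if "x \<in> {0..<1}" "y \<in> {0..<1}" "\<bar>y - x\<bar> < \<delta>" for x y
    using \<delta>(2)[of x y] that by (simp add: dist_real_def frac_eq)
  \<comment> \<open>The level is chosen so that every cell is shorter than the modulus of continuity
    \<open>\<delta>\<close>.\<close>
  obtain l where l: "1 / real (k ^ l) < \<delta>"
    using real_arch_pow_inv[of \<delta> "1 / real k"] k \<delta>(1) by (auto simp: power_divide)
  let ?p = "\<lambda>N q. (\<Sum>r<k ^ (N - l). f (q * k ^ (N - l) + r)) / block_sum k f N"
  let ?Q = "\<lambda>N. \<Sum>q\<in>{k ^ l..<k ^ (l + 1)}. ?p N q * \<phi> (block_point k l q)"
  have "convergent ?Q"
    using k by (intro convergent_sum_fun convergent_mult convergent_const cells)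
      (auto simp: Suc_le_eq intro: order.strict_trans2[rotated])
  moreover have "\<forall>\<^sub>F N in sequentially. \<bar>integral\<^sup>L (block_measure k f N) \<phi> - ?Q N\<bar> \<le> e"
    using bs eventually_ge_at_top[of l]
  proof eventually_elim
    case (elim N)
    define K where "K = k ^ (N - l)"
    have pos: "block_sum k f N > 0" using elim(1) block_sum_nonneg[OF f, of k N] by simp
    have kN: "k ^ N = k ^ l * K" "k ^ (N + 1) = k ^ (l + 1) * K"
      using elim(2) by (simp_all add: K_def flip: power_add)
    have regroup: "(\<Sum>m\<in>{k ^ N..<k ^ (N + 1)}. g m) = (\<Sum>q\<in>{k ^ l..<k ^ (l + 1)}. \<Sum>r<K. g (q * K + r))"
      for g :: "nat \<Rightarrow> real"
      unfolding kN using k by (intro sum_regroup) simp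
    let ?w = "\<lambda>m. f m / block_sum k f N"
    have diff: "integral\<^sup>L (block_measure k f N) \<phi> - ?Q N =
       (\<Sum>q\<in>{k ^ l..<k ^ (l + 1)}. \<Sum>r<K. ?w (q * K + r) * (\<phi> (block_point k N (q * K + r)) - \<phi> (block_point k l q)))"
      unfolding integral_block_measure[OF k f \<phi>] regroup
      by (simp add: K_def[symmetric] sum_subtractf right_diff_distrib sum_divide_distrib sum_distrib_right)
    \<comment> \<open>The weights \<open>?w\<close> are nonnegative and sum to 1 over the block, so
      the pointwise error \<open>e\<close> bounds the error of the integral.\<close>
    have "\<bar>integral\<^sup>L (block_measure k f N) \<phi> - ?Q N\<bar> \<le> (\<Sum>q\<in>{k ^ l..<k ^ (l + 1)}. \<Sum>r<K. ?w (q * K + r) * e)"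
      unfolding diff
    proof (intro order.trans[OF sum_abs] sum_mono)
      fix q r assume q: "q \<in> {k ^ l..<k ^ (l + 1)}" and r: "r \<in> {..<K}"
      have "q * K + r \<in> {k ^ N..<k ^ (N + 1)}"
      proof -
        have "k ^ l * K \<le> q * K" using q by simp
        moreover have "q * K + r < (q + 1) * K" using r by simp
        moreover have "(q + 1) * K \<le> k ^ (l + 1) * K" using q by (intro mult_right_mono) auto
        ultimately show ?thesis unfolding kN atLeastLessThan_iff by linarith
      qed
      then have "\<bar>\<phi> (block_point k N (q * K + r)) - \<phi> (block_point k l q)\<bar> \<le> e"
        using block_point_prefix[OF k elim(2), of q r] q r l
        by (intro uc block_point_in[OF k]) (auto simp: K_def)
      moreover have "?w (q * K + r) \<ge> 0" using f pos by simp
      ultimately show "\<bar>?w (q * K + r) * (\<phi> (block_point k N (q * K + r)) - \<phi> (block_point k l q))\<bar> \<le> ?w (q * K + r) * e"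
        by (simp only: abs_mult abs_of_nonneg mult_left_mono)
    qed
    also have "\<dots> = (\<Sum>m\<in>{k ^ N..<k ^ (N + 1)}. f m) / block_sum k f N * e"
      unfolding regroup by (simp add: sum_distrib_right sum_divide_distrib)
    also have "\<dots> = e" using pos by (simp add: block_sum_def)
    finally show ?case .
  qed
  ultimately show "\<exists>Q. convergent Q \<and> (\<forall>\<^sub>F N in sequentially. \<bar>integral\<^sup>L (block_measure k f N) \<phi> - Q N\<bar> \<le> e)"
    by blast
qed

text \<open>The interface between analysis and algebra: matrices enter only through the convergence
  of relative cell masses.\<close>

lemma ghost_measure_unique_if_cells_convergent:
  assumes k: "k \<ge> 2" and f: "\<forall>n. f n \<ge> 0"
    and bs: "\<forall>\<^sub>F N in sequentially. block_sum k f N \<noteq> 0"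
    and cells: "\<And>l q. q \<ge> 1 \<Longrightarrow>
      convergent (\<lambda>N. (\<Sum>r<k ^ (N - l). f (q * k ^ (N - l) + r)) / block_sum k f N)"
  shows "\<exists>\<mu>. {\<nu>. ghost_measure k f \<nu>} = {\<mu>} \<and> limitin weak_topology (block_measure k f) \<mu> sequentially"
proof -
  \<comment> \<open>For small \<open>N\<close> the block sum may vanish, and then
    \<open>block_measure\<close> is the null measure; the shift by \<open>N0\<close> makes every
    term a probability measure.\<close>
  from bs obtain N0 where N0: "\<And>N. N \<ge> N0 \<Longrightarrow> block_sum k f N \<noteq> 0"
    by (auto simp: eventually_sequentially)
  define M where "M n = block_measure k f (n + N0)" for n
  have "M n \<in> torus_probs" for n
    unfolding M_def by (rule block_measure_torus_probs[OF k f N0]) simp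
  moreover have "convergent (\<lambda>n. integral\<^sup>L (M n) \<phi>)" if "torus_continuous \<phi>" for \<phi>
    using integral_block_measure_convergent[OF k f bs cells that]
    unfolding M_def by (auto simp: convergent_def intro: LIMSEQ_ignore_initial_segment)
  ultimately obtain \<mu> where \<mu>: "\<mu> \<in> torus_probs"
    "\<And>\<phi>. torus_continuous \<phi> \<Longrightarrow> (\<lambda>n. integral\<^sup>L (M n) \<phi>) \<longlonglongrightarrow> integral\<^sup>L \<mu> \<phi>"
    using torus_probs_limit_exists[of M] by blast
  have "\<forall>\<^sub>F N in sequentially. block_measure k f N \<in> torus_probs"
    using bs by (rule eventually_mono) (rule block_measure_torus_probs[OF k f])
  then have lim: "limitin weak_topology (block_measure k f) \<mu> sequentially"
    using \<mu> by (intro limitin_weak_topologyI) (auto simp: M_def intro: LIMSEQ_offset[of _ N0])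
  then show ?thesis using ghost_measure_iff_limit[OF _ bs] by auto
qed

section \<open>Asymptotics of a nondegenerate representation\<close>

text \<open>The bilinear form is a fixed finite combination of matrix entries, so entrywise limits
  suffice. The target is complex because \<open>limit_mat\<close> is.\<close>

lemma scalar_prod_power_tendsto:
  fixes B :: "real mat" and L :: "complex mat"
  assumes B: "B \<in> carrier_mat d d" and x: "x \<in> carrier_vec d" and y: "y \<in> carrier_vec d"
    and L: "L \<in> carrier_mat d d"
    and lim: "\<And>i j. i < d \<Longrightarrow> j < d \<Longrightarrow>
      (\<lambda>n. complex_of_real (c n) * (map_mat complex_of_real B ^\<^sub>m n) $$ (i, j)) \<longlonglongrightarrow> L $$ (i, j)"
  shows "(\<lambda>n. complex_of_real (c n * scalar_prod x (B ^\<^sub>m n *\<^sub>v y))) \<longlonglongrightarrow>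
    scalar_prod (map_vec complex_of_real x) (L *\<^sub>v map_vec complex_of_real y)"
proof -
  have Bn: "B ^\<^sub>m n \<in> carrier_mat d d" for n using B by simp
  have e: "(map_mat complex_of_real B ^\<^sub>m n) $$ (i, j) = complex_of_real ((B ^\<^sub>m n) $$ (i, j))" if "i < d" "j < d" for i j n
  proof -
    have "map_mat complex_of_real B ^\<^sub>m n = map_mat complex_of_real (B ^\<^sub>m n)"
      by (rule of_real_hom.mat_hom_pow[OF B, symmetric])
    then show ?thesis using carrier_matD[OF Bn[of n]] that by (simp only: index_map_mat)
  qed
  have "c n * scalar_prod x (B ^\<^sub>m n *\<^sub>v y) = (\<Sum>i<d. \<Sum>j<d. x $ i * (c n * (B ^\<^sub>m n) $$ (i, j)) * y $ j)" for n
  proof -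
    have "dim_row (B ^\<^sub>m n) = d" "dim_col (B ^\<^sub>m n) = d" using Bn[of n] by auto
    then show ?thesis
      using x y by (simp add: scalar_prod_def lessThan_atLeast0 sum_distrib_left mult_ac
          del: pow_mat_dim pow_mat_dim_square)
  qed
  then have "(\<lambda>n. complex_of_real (c n * scalar_prod x (B ^\<^sub>m n *\<^sub>v y))) =
      (\<lambda>n. \<Sum>i<d. \<Sum>j<d. complex_of_real (x $ i) * (complex_of_real (c n) * (map_mat complex_of_real B ^\<^sub>m n) $$ (i, j)) * complex_of_real (y $ j))"
    by (simp add: e)
  also have "\<dots> \<longlonglongrightarrow> (\<Sum>i<d. \<Sum>j<d. complex_of_real (x $ i) * L $$ (i, j) * complex_of_real (y $ j))"
    by (intro tendsto_intros lim) auto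
  also have "(\<Sum>i<d. \<Sum>j<d. complex_of_real (x $ i) * L $$ (i, j) * complex_of_real (y $ j)) =
      scalar_prod (map_vec complex_of_real x) (L *\<^sub>v map_vec complex_of_real y)"
    using L x y by (simp add: scalar_prod_def lessThan_atLeast0 sum_distrib_left mult_ac)
  finally show ?thesis .
qed

lemma phases_eq_one:
  assumes "spectral_radius M > 0" "peripheral M = {complex_of_real (spectral_radius M)}"
  shows "phases M = (\<lambda>_. 1)"
  using assms by (auto simp: phases_def fun_eq_iff)

context representation
begin

abbreviation "M \<equiv> tilde_mat d k u A"

lemma M_carrier: "M \<in> carrier_mat d d"
  using B_carrier by (simp add: tilde_mat_eq)

lemma rotation_one: "rotation_mat d W M (\<lambda>_. 1) = 1\<^sub>m d"
  using W.rotation_mat_one[OF T_carrier] by (simp add: tilde_mat_eq B_def)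

text \<open>With trivial phases the compensating rotation is the identity and drops out; convergence
  of the remaining entries then turns \<open>lim\<close> into an actual limit.\<close>

lemma limit_mat_entry:
  assumes \<rho>: "spectral_radius M > 0" and per: "peripheral M = {complex_of_real (spectral_radius M)}"
    and ij: "i < d" "j < d"
  shows "(\<lambda>n. complex_of_real (growth_coeff M n) * (M ^\<^sub>m n) $$ (i, j)) \<longlonglongrightarrow> limit_mat d W M $$ (i, j)"
proof -
  have one: "1\<^sub>m d ^\<^sub>m n = (1\<^sub>m d :: complex mat)" for n by (induction n) auto
  have "limit_mat d W M $$ (i, j) = lim (\<lambda>n. complex_of_real (growth_coeff M n) * (M ^\<^sub>m n) $$ (i, j))"
    using ij M_carrier by (simp add: limit_mat_def Let_def phases_eq_one[OF \<rho> per] rotation_one one left_mult_one_mat[of _ d d])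
  then show ?thesis
    using power_entry_convergent[OF M_carrier \<rho> per ij] by (simp add: convergent_LIMSEQ_iff)
qed

lemma prefix_sum_eq:
  assumes v: "v \<in> carrier_vec d" and f: "\<And>n. f n = scalar_prod u (D n *\<^sub>v v)" and q: "q \<ge> 1"
  shows "(\<Sum>r<k ^ n. f (q * k ^ n + r)) = scalar_prod (row_vec q) (B ^\<^sub>m n *\<^sub>v v)"
proof -
  have "f m = scalar_prod (row_vec m) v" for m
    unfolding f row_vec_def by (rule transpose_vec_mult_scalar[OF D_carrier v u, symmetric])
  then have "(\<Sum>r<k ^ n. f (q * k ^ n + r)) = scalar_prod (row_vec q) (T ^\<^sub>m n *\<^sub>v v)"
    using sum_row_vec[OF q v, of n] by simp
  also have "\<dots> = scalar_prod (row_vec q) (B ^\<^sub>m n *\<^sub>v v)"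
    by (rule scalar_prod_T_power[OF row_vec_in[OF q] v])
  finally show ?thesis .
qed

text \<open>A block consists of the cells with leading digit from 1 to \<open>k - 1\<close>. The
  excluded leading digit 0 is the origin of the difference \<open>T - A 0\<close>, and of
  \<open>A - A\<^sub>0\<close> in the nondegeneracy condition.\<close>

lemma total_block_sum_eq:
  assumes v: "v \<in> carrier_vec d" and f: "\<And>n. f n = scalar_prod u (D n *\<^sub>v v)"
  shows "block_sum k f N = scalar_prod (transpose_mat (T - A 0) *\<^sub>v u) (B ^\<^sub>m N *\<^sub>v v)"
proof -
  define y where "y = B ^\<^sub>m N *\<^sub>v v"
  have y: "y \<in> carrier_vec d"
    unfolding y_def using B_carrier v by (intro mult_mat_vec_carrier[of _ d d]) auto
  have A0: "A 0 \<in> carrier_mat d d" using A k by simp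
  have "block_sum k f N = (\<Sum>q\<in>{1..<k}. \<Sum>r<k ^ N. f (q * k ^ N + r))"
    using sum_regroup[of 1 k f "k ^ N"] k by (simp add: block_sum_def)
  also have "\<dots> = (\<Sum>q\<in>{1..<k}. scalar_prod (transpose_mat (A q) *\<^sub>v u) y)"
    unfolding y_def by (intro sum.cong refl) (simp add: prefix_sum_eq[OF v f] row_vec_digit)
  \<comment> \<open>The term for digit 0 is added and subtracted, so that the full digit sum becomes
    \<open>T\<close>.\<close>
  also have "\<dots> = (\<Sum>q<k. scalar_prod (transpose_mat (A q) *\<^sub>v u) y) - scalar_prod (transpose_mat (A 0) *\<^sub>v u) y"
    using k by (subst lessThan_atLeast0, subst sum.atLeast_Suc_lessThan) auto
  also have "\<dots> = scalar_prod u (T *\<^sub>v y) - scalar_prod u (A 0 *\<^sub>v y)"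
    by (simp only: scalar_prod_T[OF u y] transpose_vec_mult_scalar[OF A0 y u])
  also have "\<dots> = scalar_prod u (T *\<^sub>v y - A 0 *\<^sub>v y)"
    using T_carrier A0 y by (intro scalar_prod_minus_distrib[OF u, symmetric]) (auto intro: mult_mat_vec_carrier)
  also have "T *\<^sub>v y - A 0 *\<^sub>v y = (T - A 0) *\<^sub>v y"
    by (rule minus_mult_distrib_mat_vec[OF T_carrier A0 y, symmetric])
  also have "scalar_prod u \<dots> = scalar_prod (transpose_mat (T - A 0) *\<^sub>v u) y"
    by (rule transpose_vec_mult_scalar[OF minus_carrier_mat[OF A0] y u, symmetric])
  finally show ?thesis unfolding y_def .
qed

text \<open>The limit of the normalised block sums is the quantity in the nondegeneracy condition
  for the trivial phase, after transposing \<open>T - A 0\<close> onto \<open>u\<close>; so its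
  positivity is the assumption.\<close>

lemma nondegenerate_block_sum_limit:
  assumes v: "v \<in> carrier_vec d" and f: "\<And>n. f n = scalar_prod u (D n *\<^sub>v v)"
    and nd: "nondegenerate_rep k d u A v"
    and per: "peripheral M = {complex_of_real (spectral_radius M)}"
  obtains z where "z > 0" "(\<lambda>N. growth_coeff M N * block_sum k f N) \<longlonglongrightarrow> z"
proof -
  let ?c = complex_of_real
  have \<rho>: "spectral_radius M > 0" using nd by (simp add: nondegenerate_rep_def Let_def)
  define L where "L = limit_mat d W M"
  have L: "L \<in> carrier_mat d d" by (simp add: L_def limit_mat_def Let_def)
  have A0: "A 0 \<in> carrier_mat d d" using A k by simp
  note TA = minus_carrier_mat[OF A0, of T]
  let ?x = "transpose_mat (T - A 0) *\<^sub>v u"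
  have x: "?x \<in> carrier_vec d" using TA u by (intro mult_mat_vec_carrier[of _ d d]) auto
  have cv: "map_vec ?c v \<in> carrier_vec d" and cu: "map_vec ?c u \<in> carrier_vec d" using u v by auto
  have Lv: "L *\<^sub>v map_vec ?c v \<in> carrier_vec d" by (rule mult_mat_vec_carrier[OF L cv])
  define z where "z = scalar_prod (map_vec ?c ?x) (L *\<^sub>v map_vec ?c v)"
  \<comment> \<open>All phases equal 1, so the constant 1 lies in the group, and the rotation
    belonging to it is the identity by \<open>rotation_one\<close>.\<close>
  have "(\<lambda>_. 1) \<in> phase_group M"
    unfolding phase_group_def phases_eq_one[OF \<rho> per] by (intro subsetD[OF closure_subset]) auto
  then have "0 < scalar_prod (map_vec ?c u) (map_mat ?c (T - A 0) *\<^sub>v (1\<^sub>m d *\<^sub>v (L *\<^sub>v map_vec ?c v)))"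
    using nd unfolding nondegenerate_rep_def Let_def L_def by (metis rotation_one)
  also have "1\<^sub>m d *\<^sub>v (L *\<^sub>v map_vec ?c v) = L *\<^sub>v map_vec ?c v"
    by (rule one_mult_mat_vec[OF Lv])
  also have "scalar_prod (map_vec ?c u) (map_mat ?c (T - A 0) *\<^sub>v (L *\<^sub>v map_vec ?c v)) =
      scalar_prod (transpose_mat (map_mat ?c (T - A 0)) *\<^sub>v map_vec ?c u) (L *\<^sub>v map_vec ?c v)"
    by (rule transpose_vec_mult_scalar[OF _ Lv cu, symmetric]) (use TA in simp)
  also have "transpose_mat (map_mat ?c (T - A 0)) *\<^sub>v map_vec ?c u = map_vec ?c ?x"
    using of_real_hom.mult_mat_vec_hom[of "transpose_mat (T - A 0)" d d u, where ?'a = complex] TA u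
    by (simp add: map_mat_transpose del: index_mult_mat_vec)
  finally have z: "0 < z" by (simp add: z_def)
  have "(\<lambda>n. ?c (growth_coeff M n * scalar_prod ?x (B ^\<^sub>m n *\<^sub>v v))) \<longlonglongrightarrow> z"
    unfolding z_def
    by (rule scalar_prod_power_tendsto[OF B_carrier x v L])
      (use limit_mat_entry[OF \<rho> per] in \<open>simp add: L_def tilde_mat_eq\<close>)
  then have "(\<lambda>n. Re (?c (growth_coeff M n * block_sum k f n))) \<longlonglongrightarrow> Re z"
    unfolding total_block_sum_eq[OF v f] by (rule tendsto_Re)
  then show ?thesis using that[of "Re z"] z by (simp add: less_complex_def)
qed

text \<open>The cell sum at level \<open>N\<close> is given by the power \<open>N - l\<close> of
  \<open>B\<close>. It converges under the coefficient for \<open>N - l\<close>, and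
  \<open>growth_coeff_shift\<close> trades this for the coefficient at \<open>N\<close>, at the cost
  of a constant factor.\<close>

lemma cell_sum_convergent:
  assumes v: "v \<in> carrier_vec d" and f: "\<And>n. f n = scalar_prod u (D n *\<^sub>v v)" and q: "q \<ge> 1"
    and \<rho>: "spectral_radius M > 0" and per: "peripheral M = {complex_of_real (spectral_radius M)}"
  shows "convergent (\<lambda>N. growth_coeff M N * (\<Sum>r<k ^ (N - l). f (q * k ^ (N - l) + r)))"
proof -
  let ?s = "\<lambda>n. scalar_prod (row_vec q) (B ^\<^sub>m n *\<^sub>v v)"
  have "(\<lambda>n. complex_of_real (growth_coeff M n * ?s n)) \<longlonglongrightarrow>
      scalar_prod (map_vec complex_of_real (row_vec q)) (limit_mat d W M *\<^sub>v map_vec complex_of_real v)"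
    by (rule scalar_prod_power_tendsto[OF B_carrier row_vec_carrier v])
      (use limit_mat_entry[OF \<rho> per] in \<open>simp_all add: tilde_mat_eq limit_mat_def Let_def\<close>)
  from tendsto_Re[OF this] obtain a where a: "(\<lambda>n. growth_coeff M n * ?s n) \<longlonglongrightarrow> a" by auto
  obtain p where p: "p \<longlonglongrightarrow> 1 / spectral_radius M ^ l"
    "\<forall>\<^sub>F n in sequentially. growth_coeff M (n + l) = p n * growth_coeff M n"
    by (rule growth_coeff_shift[OF \<rho>])
  have "(\<lambda>n. p n * (growth_coeff M n * ?s n)) \<longlonglongrightarrow> 1 / spectral_radius M ^ l * a"
    by (intro tendsto_intros a p(1))
  then have "(\<lambda>n. growth_coeff M (n + l) * ?s n) \<longlonglongrightarrow> 1 / spectral_radius M ^ l * a"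
    by (rule Lim_transform_eventually) (use p(2) in eventually_elim, simp)
  then have "(\<lambda>n. growth_coeff M (n + l) * (\<Sum>r<k ^ (n + l - l). f (q * k ^ (n + l - l) + r))) \<longlonglongrightarrow>
      1 / spectral_radius M ^ l * a"
    by (simp add: prefix_sum_eq[OF v f q])
  \<comment> \<open>Removing the offset \<open>l\<close> is harmless: the truncated subtraction
    \<open>N - l\<close> distorts only finitely many terms.\<close>
  then have "(\<lambda>N. growth_coeff M N * (\<Sum>r<k ^ (N - l). f (q * k ^ (N - l) + r))) \<longlonglongrightarrow>
      1 / spectral_radius M ^ l * a"
    by (rule LIMSEQ_offset)
  then show ?thesis by (auto simp: convergent_def)
qed

end

theorem corollary1:
  fixes k d :: nat and f :: "nat \<Rightarrow> real"
    and u v :: "real Matrix.vec" and A :: "nat \<Rightarrow> real mat"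
  assumes "k \<ge> 2"
    and "k_regular k f"
    and "\<forall>n. f n \<ge> 0"
    and "nondegenerate k f"
    and "minimal_rep k f d u A v"
    and "nondegenerate_rep k d u A v"
    and "peripheral (tilde_mat d k u A)
           = {complex_of_real (spectral_radius (tilde_mat d k u A))}"
  shows "\<exists>\<mu>. {\<nu>. ghost_measure k f \<nu>} = {\<mu>} \<and>
             limitin weak_topology (block_measure k f) \<mu> sequentially"
proof -
  have rep: "linear_rep k f d u A v" using assms(5) unfolding minimal_rep_def by blast
  interpret representation k d u A
    using rep assms(1) by unfold_locales (auto simp: linear_rep_def)
  have v: "v \<in> carrier_vec d" and f: "\<And>n. f n = scalar_prod u (D n *\<^sub>v v)"
    using rep by (auto simp: linear_rep_def)
  have \<rho>: "spectral_radius M > 0" using assms(6) by (simp add: nondegenerate_rep_def Let_def)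
  obtain z where z: "z > 0" "(\<lambda>N. growth_coeff M N * block_sum k f N) \<longlonglongrightarrow> z"
    by (rule nondegenerate_block_sum_limit[OF v f assms(6,7)])
  \<comment> \<open>A positive limit of the normalised block sums keeps the sums away from 0 for
    large \<open>N\<close>.\<close>
  have bs: "\<forall>\<^sub>F N in sequentially. block_sum k f N \<noteq> 0"
    using order_tendstoD(1)[OF z(2,1)] by eventually_elim auto
  show ?thesis
  proof (rule ghost_measure_unique_if_cells_convergent[OF assms(1,3) bs])
    fix l q :: nat assume "q \<ge> 1"
    then obtain a where a: "(\<lambda>N. growth_coeff M N * (\<Sum>r<k ^ (N - l). f (q * k ^ (N - l) + r))) \<longlonglongrightarrow> a"
      using cell_sum_convergent[OF v f _ \<rho> assms(7)] by (auto simp: convergent_def)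
    have "(\<lambda>N. (growth_coeff M N * (\<Sum>r<k ^ (N - l). f (q * k ^ (N - l) + r))) /
        (growth_coeff M N * block_sum k f N)) \<longlonglongrightarrow> a / z"
      using z by (intro tendsto_divide a) auto
    then have "(\<lambda>N. (\<Sum>r<k ^ (N - l). f (q * k ^ (N - l) + r)) / block_sum k f N) \<longlonglongrightarrow> a / z"
    proof (rule Lim_transform_eventually)
      show "\<forall>\<^sub>F N in sequentially. (growth_coeff M N * (\<Sum>r<k ^ (N - l). f (q * k ^ (N - l) + r))) /
          (growth_coeff M N * block_sum k f N) =
          (\<Sum>r<k ^ (N - l). f (q * k ^ (N - l) + r)) / block_sum k f N"
        \<comment> \<open>Cancelling needs a nonzero coefficient, but
          \<open>growth_coeff M 0\<close> may be 0 through division by 0.\<close>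
        using eventually_gt_at_top[of 0]
        by eventually_elim (use growth_coeff_pos[OF \<rho>] in \<open>simp add: less_imp_neq[symmetric]\<close>)
    qed
    then show "convergent (\<lambda>N. (\<Sum>r<k ^ (N - l). f (q * k ^ (N - l) + r)) / block_sum k f N)"
      by (auto simp: convergent_def)
  qed
qed

end
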